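(* There exists a universal constant $K>0$ such that the following holds. Let $n\ge1$, let $\rho$ be an $n$-qubit mixed state, let $\mathcal{D}$ be a probability distribution over two-outcome measurements on $n$ qubits, and let $\mathcal{E}=(E_1,\ldots,E_m)$ consist of $m$ measurements drawn independently from $\mathcal{D}$. Fix $\varepsilon,\eta,\gamma>0$ with $\gamma>\eta$, and $\delta\in(0,1)$. Call $\mathcal{E}$ good if every $n$-qubit mixed state $\sigma$ with $|\operatorname{Tr}(E_i\sigma)-\operatorname{Tr}(E_i\rho)|\le\eta$ for all $i$ also satisfies $\Pr_{E\sim\mathcal{D}}[|\operatorname{Tr}(E\sigma)-\operatorname{Tr}(E\rho)|>\gamma]\le\varepsilon$. Then $\mathcal{E}$ is good with probability at least $1-\delta$, provided that \[m\ge\frac{K}{\varepsilon}\left(\frac{n}{(\gamma-\eta)^2}\log^2\frac{n}{(\gamma-\eta)\varepsilon}+\log\frac1\delta\right).\]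
   Context: An $n$-qubit mixed state is a $2^n\times2^n$ Hermitian positive semidefinite matrix of trace $1$. A two-outcome measurement on $n$ qubits is a $2^n\times2^n$ Hermitian matrix $E$ with eigenvalues in $[0,1]$; it accepts $\rho$ with probability $\operatorname{Tr}(E\rho)$. *)

theory Defs
  imports "HOL-Probability.Probability" "Jordan_Normal_Form.Char_Poly"
begin

definition mtrace :: "complex mat \<Rightarrow> complex" where
  "mtrace A = (\<Sum>i<dim_row A. A $$ (i, i))"

definition hermitian_mat :: "nat \<Rightarrow> complex mat \<Rightarrow> bool" where
  "hermitian_mat d A \<longleftrightarrow> A \<in> carrier_mat d d \<and>
     (\<forall>i<d. \<forall>j<d. A $$ (j, i) = cnj (A $$ (i, j)))"

definition psd_mat :: "nat \<Rightarrow> complex mat \<Rightarrow> bool" where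
  "psd_mat d A \<longleftrightarrow> hermitian_mat d A \<and>
     (\<forall>v \<in> carrier_vec d. 0 \<le> Re (\<Sum>i<d. \<Sum>j<d. cnj (v $ i) * A $$ (i, j) * v $ j))"

definition qstate :: "nat \<Rightarrow> complex mat \<Rightarrow> bool" where
  "qstate n \<rho> \<longleftrightarrow> psd_mat (2 ^ n) \<rho> \<and> mtrace \<rho> = 1"

definition measurement :: "nat \<Rightarrow> complex mat \<Rightarrow> bool" where
  "measurement n E \<longleftrightarrow> hermitian_mat (2 ^ n) E \<and>
     (\<forall>k. eigenvalue E k \<longrightarrow> Im k = 0 \<and> 0 \<le> Re k \<and> Re k \<le> 1)"

definition acc :: "complex mat \<Rightarrow> complex mat \<Rightarrow> complex" where
  "acc E \<rho> = mtrace (E * \<rho>)"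

definition good :: "nat \<Rightarrow> complex mat \<Rightarrow> complex mat measure \<Rightarrow> real \<Rightarrow> real \<Rightarrow> real
    \<Rightarrow> nat \<Rightarrow> (nat \<Rightarrow> complex mat) \<Rightarrow> bool" where
  "good n \<rho> D \<epsilon> \<eta> \<gamma> m Es \<longleftrightarrow>
     (\<forall>\<sigma>. qstate n \<sigma> \<longrightarrow> (\<forall>i<m. cmod (acc (Es i) \<sigma> - acc (Es i) \<rho>) \<le> \<eta>) \<longrightarrow>
        measure D {E \<in> space D. cmod (acc E \<sigma> - acc E \<rho>) > \<gamma>} \<le> \<epsilon>)"

end

theory Submission
  imports Defs "Jordan_Normal_Form.Schur_Decomposition" "Jordan_Normal_Form.Jordan_Normal_Form_Uniqueness"
begin

text \<open>Replace each effect \<open>E\<close> by \<open>H = 2E - 1\<close>. On any finite list of effects the values \<open>Tr (H \<sigma>)\<close> of a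
  state can be approximated up to \<open>\<alpha>\<close> by an online algorithm that makes only \<open>O(n / \<alpha>\<^sup>2)\<close> corrections:
  keep a signed sum \<open>A\<close> of effects, predict with the gradient of the squared Schatten \<open>q\<close>-norm at \<open>A\<close>,
  where \<open>q\<close> is a power of two of order \<open>n\<close>, and add the offending effect with the appropriate sign whenever
  a prediction is wrong by more than \<open>\<alpha>\<close>. The squared norm is smooth with constant \<open>O(q)\<close> and
  \<open>Tr (A \<sigma>) \<le> \<parallel>A\<parallel>\<^sub>q\<close>, which bounds the number of corrections. Both facts
  follow from the Cauchy-Schwarz inequality for the trace, without diagonalising \<open>A\<close>.

  Hence on \<open>2m\<close> effects the class of states has a sup-norm cover of size \<open>(4m + 1)\<^sup>T\<close> with
  \<open>T = O(n / \<alpha>\<^sup>2)\<close>, whose members are named by lists of signed sample indices. This naming is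
  equivariant under permutations of the sample, so the ghost sample argument with random swaps applies
  and bounds the failure probability by \<open>2 (4m + 1)\<^sup>T 2\<^bsup>-\<epsilon>m/2\<^esup>\<close>.

  The logarithm in the sample size vanishes when \<open>n = 1\<close> and \<open>\<gamma> - \<eta>\<close> and \<open>\<epsilon>\<close> are close to \<open>1\<close>. For a
  single qubit and \<open>\<gamma> - \<eta> \<ge> 9/10\<close> all states that are far from \<open>\<rho>\<close> nearly coincide, so that
  it suffices to sample one effect that detects a fixed one of them.\<close>

section \<open>Traces of matrices\<close>

text \<open>Matrices are plain functions, so that products are associative and traces cyclic without side
  conditions; only the identity requires entries outside \<open>{..<d}\<close> to vanish, which \<open>herm\<close> ensures.\<close>

definition mmul :: "nat \<Rightarrow> (nat \<Rightarrow> nat \<Rightarrow> complex) \<Rightarrow> (nat \<Rightarrow> nat \<Rightarrow> complex) \<Rightarrow> nat \<Rightarrow> nat \<Rightarrow> complex" where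
  "mmul d A B = (\<lambda>i j. \<Sum>k<d. A i k * B k j)"

definition madj :: "(nat \<Rightarrow> nat \<Rightarrow> complex) \<Rightarrow> nat \<Rightarrow> nat \<Rightarrow> complex" where
  "madj A = (\<lambda>i j. cnj (A j i))"

text \<open>Taking the real part makes \<open>mtr d (X S madj Y)\<close> a symmetric real bilinear
  form in \<open>X\<close> and \<open>Y\<close> for Hermitian \<open>S\<close>, so a real
  discriminant argument gives Cauchy-Schwarz.\<close>

definition mtr :: "nat \<Rightarrow> (nat \<Rightarrow> nat \<Rightarrow> complex) \<Rightarrow> real" where
  "mtr d A = Re (\<Sum>i<d. A i i)"

definition mone :: "nat \<Rightarrow> nat \<Rightarrow> nat \<Rightarrow> complex" where
  "mone d = (\<lambda>i j. if i = j \<and> i < d then 1 else 0)"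

primrec mpow :: "nat \<Rightarrow> (nat \<Rightarrow> nat \<Rightarrow> complex) \<Rightarrow> nat \<Rightarrow> nat \<Rightarrow> nat \<Rightarrow> complex" where
  "mpow d A 0 = mone d"
| "mpow d A (Suc k) = mmul d A (mpow d A k)"

text \<open>One operation serves for differences (\<open>s = - 1\<close>), real multiples (zero as
  \<open>A\<close>) and the line along which the potential is differentiated.\<close>

definition mlin :: "(nat \<Rightarrow> nat \<Rightarrow> complex) \<Rightarrow> real \<Rightarrow> (nat \<Rightarrow> nat \<Rightarrow> complex) \<Rightarrow> nat \<Rightarrow> nat \<Rightarrow> complex" where
  "mlin A s B = (\<lambda>i j. A i j + of_real s * B i j)"

definition herm :: "nat \<Rightarrow> (nat \<Rightarrow> nat \<Rightarrow> complex) \<Rightarrow> bool" where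
  "herm d A \<longleftrightarrow> madj A = A \<and> (\<forall>i j. i \<ge> d \<longrightarrow> A i j = 0)"

definition posf :: "nat \<Rightarrow> (nat \<Rightarrow> nat \<Rightarrow> complex) \<Rightarrow> bool" where
  "posf d S \<longleftrightarrow> herm d S \<and> (\<forall>v. 0 \<le> Re (\<Sum>i<d. \<Sum>j<d. cnj (v i) * S i j * v j))"

lemma mmul_assoc: "mmul d (mmul d A B) C = mmul d A (mmul d B C)"
  unfolding mmul_def
  by (intro ext) (simp add: sum_distrib_left sum_distrib_right mult.assoc, rule sum.swap)

lemma mtr_comm: "mtr d (mmul d A B) = mtr d (mmul d B A)"
proof -
  have "(\<Sum>i<d. \<Sum>k<d. A i k * B k i) = (\<Sum>k<d. \<Sum>i<d. B k i * A i k)"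
    by (subst sum.swap) (simp add: mult.commute)
  then show ?thesis unfolding mtr_def mmul_def by simp
qed

lemma madj_mmul: "madj (mmul d A B) = mmul d (madj B) (madj A)"
  unfolding mmul_def madj_def by (simp add: mult.commute)

lemma madj_madj [simp]: "madj (madj A) = A" by (simp add: madj_def)

lemma mtr_madj: "mtr d (madj A) = mtr d A"
  by (simp add: mtr_def madj_def)

lemma madj_mlin: "madj (mlin A s B) = mlin (madj A) s (madj B)"
  by (simp add: mlin_def madj_def)

lemma mmul_mlin_left: "mmul d (mlin A s B) C = mlin (mmul d A C) s (mmul d B C)"
  by (simp add: mlin_def mmul_def algebra_simps sum.distrib sum_distrib_left)

lemma mmul_mlin_right: "mmul d C (mlin A s B) = mlin (mmul d C A) s (mmul d C B)"
  by (simp add: mlin_def mmul_def algebra_simps sum.distrib sum_distrib_left)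

lemma mtr_mlin: "mtr d (mlin A s B) = mtr d A + s * mtr d B"
  by (simp add: mlin_def mtr_def sum.distrib algebra_simps flip: sum_distrib_left)

lemma herm_adj: "herm d A \<Longrightarrow> madj A = A" by (simp add: herm_def)

lemma herm_outside: "herm d A \<Longrightarrow> i \<ge> d \<or> j \<ge> d \<Longrightarrow> A i j = 0"
proof -
  assume h: "herm d A" and "i \<ge> d \<or> j \<ge> d"
  moreover have "A i j = cnj (A j i)" using h by (metis herm_def madj_def)
  ultimately show ?thesis by (auto simp: herm_def)
qed

lemma mone_mmul: "(\<And>i j. i \<ge> d \<Longrightarrow> A i j = 0) \<Longrightarrow> mmul d (mone d) A = A"
  unfolding mone_def mmul_def
  by (intro ext) (auto simp: if_distrib[of "\<lambda>x. x * _"] sum.delta cong: if_cong conj_cong)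

lemma mmul_mone: "(\<And>i j. j \<ge> d \<Longrightarrow> A i j = 0) \<Longrightarrow> mmul d A (mone d) = A"
  unfolding mone_def mmul_def
  by (intro ext) (auto simp: if_distrib[of "\<lambda>x. _ * x"] sum.delta cong: if_cong conj_cong)

lemma herm_mone: "herm d (mone d)"
  by (auto simp: herm_def mone_def madj_def fun_eq_iff)

lemma herm_mlin: "herm d A \<Longrightarrow> herm d B \<Longrightarrow> herm d (mlin A s B)"
  by (auto simp: herm_def madj_mlin) (simp add: mlin_def)

lemma mone_herm [simp]: "herm d A \<Longrightarrow> mmul d (mone d) A = A"
  by (rule mone_mmul) (auto simp: herm_outside)

lemma herm_mone_right [simp]: "herm d A \<Longrightarrow> mmul d A (mone d) = A"
  by (rule mmul_mone) (auto simp: herm_outside)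

lemma mpow_outside: "herm d A \<Longrightarrow> i \<ge> d \<or> j \<ge> d \<Longrightarrow> mpow d A k i j = 0"
  by (induction k arbitrary: i j) (auto simp: mone_def mmul_def herm_outside)

lemma mpow_add: assumes "herm d A" shows "mmul d (mpow d A i) (mpow d A j) = mpow d A (i + j)"
proof (induction i)
  case 0
  then show ?case using mone_mmul[of d "mpow d A j"] mpow_outside[OF assms] by simp
next
  case (Suc i)
  then show ?case by (simp add: mmul_assoc)
qed

lemma herm_mpow: assumes "herm d A" shows "herm d (mpow d A k)"
proof -
  have "madj (mpow d A k) = mpow d A k"
  proof (induction k)
    case 0 show ?case by (simp add: herm_adj[OF herm_mone])
  next
    case (Suc k)
    have "madj (mpow d A (Suc k)) = mmul d (mpow d A k) (mpow d A 1)"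
      using assms Suc by (simp add: madj_mmul herm_adj)
    also have "\<dots> = mpow d A (Suc k)" by (subst mpow_add[OF assms]) simp
    finally show ?case .
  qed
  then show ?thesis unfolding herm_def using mpow_outside[OF assms] by simp
qed

lemma mpow_mpow: assumes "herm d A" shows "mpow d (mpow d A i) j = mpow d A (i * j)"
  by (induction j) (simp_all add: mpow_add[OF assms])

section \<open>Positive semidefinite matrices\<close>

lemma posf_herm: "posf d S \<Longrightarrow> herm d S" by (simp add: posf_def)

text \<open>Each diagonal entry of the product is the quadratic form of \<open>S\<close> at a
  conjugated row of \<open>X\<close>.\<close>

lemma posf_mtr_nonneg: assumes "posf d S" shows "0 \<le> mtr d (mmul d X (mmul d S (madj X)))"
proof -
  have "mtr d (mmul d X (mmul d S (madj X))) = (\<Sum>i<d. Re (\<Sum>j<d. \<Sum>k<d. cnj (cnj (X i j)) * S j k * cnj (X i k)))"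
    unfolding mtr_def mmul_def madj_def by (simp add: sum_distrib_left mult.assoc)
  also have "\<dots> \<ge> 0" using assms by (intro sum_nonneg) (simp only: posf_def)
  finally show ?thesis .
qed

lemma posf_mone: "posf d (mone d)"
proof -
  have "0 \<le> Re (\<Sum>i<d. \<Sum>j<d. cnj (v i) * mone d i j * v j)" for v
  proof -
    have "(\<Sum>i<d. \<Sum>j<d. cnj (v i) * mone d i j * v j) = (\<Sum>i<d. cnj (v i) * v i)"
      by (intro sum.cong refl) (simp add: mone_def if_distrib[of "\<lambda>x. _ * x * _"] sum.delta cong: if_cong conj_cong)
    then show ?thesis by (simp add: sum_nonneg)
  qed
  then show ?thesis by (simp add: posf_def herm_mone)
qed

text \<open>The quadratic form of \<open>X X\<close> at \<open>v\<close> is the squared norm of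
  \<open>X v\<close>.\<close>

lemma posf_sq: assumes "herm d X" shows "posf d (mmul d X X)"
proof -
  have h: "herm d (mmul d X X)" using assms
    by (auto simp: herm_def madj_mmul) (simp add: mmul_def)
  have "0 \<le> Re (\<Sum>i<d. \<Sum>j<d. cnj (v i) * mmul d X X i j * v j)" for v
  proof -
    have a: "cnj (X k i) = X i k" for i k using assms by (metis herm_def madj_def)
    have "(\<Sum>i<d. \<Sum>j<d. cnj (v i) * mmul d X X i j * v j)
        = (\<Sum>i<d. \<Sum>j<d. \<Sum>k<d. (cnj (v i) * X i k) * (X k j * v j))"
      unfolding mmul_def by (simp add: sum_distrib_left sum_distrib_right mult.assoc)
    also have "\<dots> = (\<Sum>i<d. \<Sum>k<d. \<Sum>j<d. (cnj (v i) * X i k) * (X k j * v j))"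
      by (intro sum.cong refl sum.swap)
    also have "\<dots> = (\<Sum>k<d. \<Sum>i<d. \<Sum>j<d. (cnj (v i) * X i k) * (X k j * v j))"
      by (rule sum.swap)
    also have "\<dots> = (\<Sum>k<d. (\<Sum>i<d. cnj (v i) * X i k) * (\<Sum>j<d. X k j * v j))"
      by (simp add: sum_product)
    also have "\<dots> = (\<Sum>k<d. cnj (\<Sum>i<d. X k i * v i) * (\<Sum>j<d. X k j * v j))"
      by (simp add: a mult.commute)
    finally have eq: "(\<Sum>i<d. \<Sum>j<d. cnj (v i) * mmul d X X i j * v j)
      = (\<Sum>k<d. cnj (\<Sum>i<d. X k i * v i) * (\<Sum>j<d. X k j * v j))" .
    have "0 \<le> Re (\<Sum>k<d. cnj (w k) * w k)" for w :: "nat \<Rightarrow> complex"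
      by (simp add: sum_nonneg)
    then show ?thesis unfolding eq .
  qed
  then show ?thesis using h by (simp add: posf_def)
qed

section \<open>The Cauchy-Schwarz inequality and the bound of a positive matrix by its trace\<close>

lemma quadratic_discriminant_le:
  fixes a b c :: real
  assumes "\<And>t. 0 \<le> a + 2 * t * b + t\<^sup>2 * c" shows "b\<^sup>2 \<le> a * c"
proof (cases "c = 0")
  case True
  have "b = 0"
  proof (rule ccontr)
    assume "b \<noteq> 0"
    \<comment> \<open>With \<open>c = 0\<close> the expression is linear in \<open>t\<close>, and at
      this point it equals -1.\<close>
    then show False using assms[of "- (a + 1) / (2 * b)"] True by (simp add: field_simps)
  qed
  then show ?thesis using True by simp
next
  case False
  have "0 \<le> c"
  proof (rule ccontr)
    assume "\<not> 0 \<le> c"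
    then have c: "c < 0" by simp
    have a: "0 \<le> a" using assms[of 0] by simp
    \<comment> \<open>Here a + t^2 c = -1; adding the values at \<open>t\<close> and
      \<open>- t\<close> cancels the linear term and leaves -2.\<close>
    define t where "t = sqrt ((a + 1) / - c)"
    have "t\<^sup>2 = (a + 1) / - c" using a c by (simp add: t_def divide_nonneg_neg)
    then have "t\<^sup>2 * c = - (a + 1)" using c by simp
    then show False using assms[of t] assms[of "- t"] by simp
  qed
  then have c: "c > 0" using False by simp
  have "0 \<le> a + 2 * (- b / c) * b + (- b / c)\<^sup>2 * c" by (rule assms)
  also have "\<dots> = a - b\<^sup>2 / c" using c by (simp add: field_simps power2_eq_square)
  finally show ?thesis using c by (simp add: field_simps)
qed

lemma mtr_mlin_sq:
  "mtr d (mmul d (mlin X t Y) (mmul d S (madj (mlin X t Y))))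
   = mtr d (mmul d X (mmul d S (madj X)))
     + t * (mtr d (mmul d X (mmul d S (madj Y))) + mtr d (mmul d Y (mmul d S (madj X))))
     + t\<^sup>2 * mtr d (mmul d Y (mmul d S (madj Y)))"
  by (simp add: madj_mlin mmul_mlin_left mmul_mlin_right mtr_mlin power2_eq_square algebra_simps)

text \<open>The form is nonnegative at X + tY for every real t, so its discriminant in t is not
  positive.\<close>

lemma posf_Cauchy_Schwarz:
  assumes "posf d S"
  shows "(mtr d (mmul d X (mmul d S (madj Y))))\<^sup>2
    \<le> mtr d (mmul d X (mmul d S (madj X))) * mtr d (mmul d Y (mmul d S (madj Y)))"
proof (rule quadratic_discriminant_le)
  fix t
  have "mtr d (mmul d Y (mmul d S (madj X))) = mtr d (mmul d X (mmul d S (madj Y)))"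
    by (subst mtr_madj[symmetric]) (simp add: madj_mmul mmul_assoc herm_adj[OF posf_herm[OF assms]])
  then show "0 \<le> mtr d (mmul d X (mmul d S (madj X))) + 2 * t * mtr d (mmul d X (mmul d S (madj Y)))
      + t\<^sup>2 * mtr d (mmul d Y (mmul d S (madj Y)))"
    using posf_mtr_nonneg[OF assms, of "mlin X t Y"] by (simp add: mtr_mlin_sq algebra_simps)
qed

lemma mtr_Cauchy_Schwarz:
  assumes "herm d X" "herm d Y"
  shows "(mtr d (mmul d X Y))\<^sup>2 \<le> mtr d (mmul d X X) * mtr d (mmul d Y Y)"
  using posf_Cauchy_Schwarz[OF posf_mone, of d X Y] assms by (simp add: herm_adj)

lemma mtr_sq_nonneg: "herm d X \<Longrightarrow> 0 \<le> mtr d (mmul d X X)"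
  using posf_mtr_nonneg[OF posf_mone, of d X] by (simp add: herm_adj)

text \<open>Cauchy-Schwarz against the identity: for an unnormalised state, the squared mean is
  bounded by the second moment.\<close>

lemma posf_mtr_mul_sq:
  assumes "posf d S" "herm d A"
  shows "(mtr d (mmul d A S))\<^sup>2 \<le> mtr d (mmul d (mmul d A A) S) * mtr d S"
proof -
  have S: "herm d S" using assms posf_herm by blast
  have "mtr d (mmul d (mmul d A A) S) = mtr d (mmul d A (mmul d S A))"
    by (subst mtr_comm) (simp add: mmul_assoc mtr_comm[of d A])
  then show ?thesis
    using posf_Cauchy_Schwarz[OF assms(1), of A "mone d"] assms S
    by (simp add: herm_adj herm_adj[OF herm_mone])
qed

text \<open>Summed over \<open>i\<close> and \<open>j\<close>, this gives S \<le> Tr(S) 1 without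
  eigenvalues. For distinct indices it expresses positivity of a 2 by 2 principal submatrix.\<close>

lemma posf_entry:
  assumes "posf d S" "i < d" "j < d"
  shows "2 * Re (cnj (v i) * S i j * v j) \<le> (cmod (v j))\<^sup>2 * Re (S i i) + (cmod (v i))\<^sup>2 * Re (S j j)"
proof (cases "i = j")
  case True
  have r: "Im (S i i) = 0"
  proof -
    have "S i i = cnj (S i i)" using assms(1) by (metis posf_herm herm_def madj_def)
    then show ?thesis by (metis complex_cnj_cancel_iff complex_eq_iff complex_cnj neg_equal_zero complex.sel(2) cnj.simps(2))
  qed
  show ?thesis using True r unfolding cmod_power2 by (simp add: power2_eq_square algebra_simps)
next
  case False
  \<comment> \<open>The entries of \<open>v\<close> at \<open>i\<close> and \<open>j\<close> are
    exchanged, conjugated, and one is negated; the cross terms of the form then become exactly the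
    ones to be bounded.\<close>
  define w where "w = (\<lambda>k. if k = i then cnj (v j) else if k = j then - cnj (v i) else 0)"
  have ji: "S j i = cnj (S i j)" using assms(1) by (metis posf_herm herm_def madj_def)
  have *: "(\<Sum>k<d. f k) = f i + f j" if "\<And>k. k \<noteq> i \<Longrightarrow> k \<noteq> j \<Longrightarrow> f k = 0" for f :: "nat \<Rightarrow> complex"
  proof -
    have "(\<Sum>k<d. f k) = (\<Sum>k\<in>{i, j}. f k)"
      using assms that by (intro sum.mono_neutral_right) auto
    then show ?thesis using False by simp
  qed
  have "0 \<le> Re (\<Sum>a<d. \<Sum>b<d. cnj (w a) * S a b * w b)"
    using assms(1) by (simp add: posf_def)
  also have "(\<Sum>a<d. \<Sum>b<d. cnj (w a) * S a b * w b)
      = (cnj (w i) * S i i * w i + cnj (w i) * S i j * w j) + (cnj (w j) * S j i * w i + cnj (w j) * S j j * w j)"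
    by (subst *, simp add: w_def, subst (1 2) *) (auto simp: w_def)
  also have "\<dots> = (v j * cnj (v j)) * S i i + (v i * cnj (v i)) * S j j
      - (cnj (v i) * S i j * v j + cnj (cnj (v i) * S i j * v j))"
    using False by (simp add: w_def ji algebra_simps)
  also have "Re \<dots> = (cmod (v j))\<^sup>2 * Re (S i i) + (cmod (v i))\<^sup>2 * Re (S j j) - 2 * Re (cnj (v i) * S i j * v j)"
    by (simp only: complex_norm_square[symmetric] plus_complex.sel minus_complex.sel complex_cnj cnj.sel Re_complex_of_real times_complex.sel Im_complex_of_real)
       simp
  finally show ?thesis by simp
qed

lemma posf_quadratic_le_trace:
  assumes "posf d S"
  shows "Re (\<Sum>i<d. \<Sum>j<d. cnj (v i) * S i j * v j) \<le> mtr d S * (\<Sum>i<d. (cmod (v i))\<^sup>2)"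
proof -
  have "2 * Re (\<Sum>i<d. \<Sum>j<d. cnj (v i) * S i j * v j) = (\<Sum>i<d. \<Sum>j<d. 2 * Re (cnj (v i) * S i j * v j))"
    by (simp only: Re_sum sum_distrib_left)
  also have "\<dots> \<le> (\<Sum>i<d. \<Sum>j<d. (cmod (v j))\<^sup>2 * Re (S i i) + (cmod (v i))\<^sup>2 * Re (S j j))"
    by (intro sum_mono posf_entry[OF assms]) auto
  also have "\<dots> = 2 * (mtr d S * (\<Sum>i<d. (cmod (v i))\<^sup>2))"
    by (simp add: sum.distrib mtr_def Re_sum algebra_simps flip: sum_distrib_left sum_distrib_right)
  finally show ?thesis by simp
qed

lemma mtr_mmul_madj: "mtr d (mmul d X (madj X)) = (\<Sum>i<d. \<Sum>j<d. (cmod (X i j))\<^sup>2)"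
  unfolding mtr_def mmul_def madj_def cmod_power2 by (simp add: power2_eq_square)

lemma posf_mtr_le:
  assumes "posf d S"
  shows "mtr d (mmul d X (mmul d S (madj X))) \<le> mtr d S * mtr d (mmul d X (madj X))"
proof -
  have "mtr d (mmul d X (mmul d S (madj X))) = (\<Sum>i<d. Re (\<Sum>j<d. \<Sum>k<d. cnj (cnj (X i j)) * S j k * cnj (X i k)))"
    unfolding mtr_def mmul_def madj_def by (simp add: sum_distrib_left mult.assoc)
  also have "\<dots> \<le> (\<Sum>i<d. mtr d S * (\<Sum>j<d. (cmod (cnj (X i j)))\<^sup>2))"
    by (intro sum_mono posf_quadratic_le_trace assms)
  also have "\<dots> = mtr d S * mtr d (mmul d X (madj X))"
    by (simp add: mtr_mmul_madj sum_distrib_left)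
  finally show ?thesis .
qed

lemma posf_mtr_nn: "posf d S \<Longrightarrow> 0 \<le> mtr d S"
  using posf_mtr_nonneg[of d S "mone d"] by (simp add: herm_adj[OF herm_mone] posf_herm)

text \<open>For Hermitian \<open>H\<close> this says that all eigenvalues lie in \<open>[-1, 1]\<close>; the moments are all that is used.\<close>

definition contraction :: "nat \<Rightarrow> (nat \<Rightarrow> nat \<Rightarrow> complex) \<Rightarrow> bool" where
  "contraction d H \<longleftrightarrow> herm d H \<and> (\<forall>r. mtr d (mpow d H (2 ^ r)) \<le> real d)"

lemma contraction_herm: "contraction d H \<Longrightarrow> herm d H"
  by (simp add: contraction_def)

section \<open>Values of observables in a state, bounded by power moments\<close>

lemma mtr_mone: "mtr d (mone d) = real d"
  by (simp add: mtr_def mone_def)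

lemma mpow_square: "herm d A \<Longrightarrow> mmul d (mpow d A k) (mpow d A k) = mpow d A (2 * k)"
  by (simp add: mpow_add mult_2)

lemma posf_mtr_mpow_le:
  assumes "posf d S" "herm d A"
  shows "mtr d (mmul d (mpow d A (2 * k)) S) \<le> mtr d S * mtr d (mpow d A (2 * k))"
proof -
  let ?X = "mpow d A k"
  have X: "madj ?X = ?X" using herm_mpow[OF assms(2)] by (rule herm_adj)
  have "mtr d (mmul d (mpow d A (2 * k)) S) = mtr d (mmul d ?X (mmul d S ?X))"
    unfolding mpow_square[OF assms(2), symmetric] mmul_assoc
    by (subst mtr_comm) (simp add: mmul_assoc)
  then show ?thesis using posf_mtr_le[OF assms(1), of ?X] by (simp add: X mpow_square[OF assms(2)])
qed

text \<open>Each use of the second moment bound doubles the exponent. The case \<open>r = 0\<close>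
  fails for negative values, since only the left side has an absolute value.\<close>

lemma state_mtr_power:
  assumes "posf d S" "mtr d S = 1" "herm d A" "r \<ge> 1"
  shows "\<bar>mtr d (mmul d A S)\<bar> ^ (2 ^ r) \<le> mtr d (mmul d (mpow d A (2 ^ r)) S)"
  using assms(4)
proof (induction r rule: nat_induct_at_least)
  case base
  have "(mtr d (mmul d A S))\<^sup>2 \<le> mtr d (mmul d (mmul d A A) S)"
    using posf_mtr_mul_sq[OF assms(1,3)] assms(2) by simp
  then show ?case using assms(3) by (simp add: numeral_2_eq_2)
next
  case (Suc r)
  have "\<bar>mtr d (mmul d A S)\<bar> ^ (2 ^ Suc r) = (\<bar>mtr d (mmul d A S)\<bar> ^ (2 ^ r))\<^sup>2"
    by (simp add: power_mult[symmetric] mult.commute)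
  also have "\<dots> \<le> (mtr d (mmul d (mpow d A (2 ^ r)) S))\<^sup>2"
    using Suc.IH by (intro power_mono) auto
  also have "\<dots> \<le> mtr d (mmul d (mmul d (mpow d A (2 ^ r)) (mpow d A (2 ^ r))) S)"
    using posf_mtr_mul_sq[OF assms(1) herm_mpow[OF assms(3)]] assms(2) by simp
  also have "\<dots> = mtr d (mmul d (mpow d A (2 ^ Suc r)) S)" by (simp add: mpow_square[OF assms(3)])
  finally show ?case .
qed

text \<open>This is |Tr(A S)| \<le> ||A||_q for q = 2^r: the power of \<open>A\<close> is a square,
  and S \<le> 1 because the trace of \<open>S\<close> is 1.\<close>

lemma state_mtr_power_le:
  assumes "posf d S" "mtr d S = 1" "herm d A" "r \<ge> 1"
  shows "\<bar>mtr d (mmul d A S)\<bar> ^ (2 ^ r) \<le> mtr d (mpow d A (2 ^ r))"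
proof -
  have e: "(2::nat) ^ r = 2 * 2 ^ (r - 1)" using assms(4) by (simp add: power_eq_if)
  show ?thesis
    using state_mtr_power[OF assms] posf_mtr_mpow_le[OF assms(1,3), of "2 ^ (r - 1)"] assms(2)
    unfolding e by simp
qed

text \<open>A value above 1 would have powers exceeding \<open>d\<close>, while all the moments of
  \<open>H\<close> stay below \<open>d\<close>.\<close>

lemma state_contraction_abs_le:
  assumes S: "posf d S" "mtr d S = 1" and H: "contraction d H"
  shows "\<bar>mtr d (mmul d H S)\<bar> \<le> 1"
proof (rule ccontr)
  define x where "x = \<bar>mtr d (mmul d H S)\<bar>"
  assume "\<not> ?thesis"
  then have x: "x > 1" by (simp add: x_def)
  obtain N where N: "real d < x ^ N" using real_arch_pow[OF x] by blast
  have h: "herm d H" using H by (simp add: contraction_def)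
  have "N < 2 ^ N" by (rule less_exp)
  then have "N \<le> 2 ^ Suc N" unfolding power_Suc by linarith
  then have "x ^ N \<le> x ^ (2 ^ Suc N)"
    using x by (intro power_increasing) auto
  also have "\<dots> \<le> mtr d (mpow d H (2 ^ Suc N))"
    unfolding x_def by (rule state_mtr_power_le[OF S h]) simp
  also have "\<dots> \<le> real d" using H unfolding contraction_def by blast
  finally show False using N by simp
qed

lemma contraction_square: "contraction d H \<Longrightarrow> contraction d (mmul d H H)"
proof -
  assume H: "contraction d H"
  then have h: "herm d H" by (simp add: contraction_def)
  then have e: "mmul d H H = mpow d H 2" by (simp add: numeral_2_eq_2)
  have "mpow d (mmul d H H) (2 ^ r) = mpow d H (2 ^ Suc r)" for r
    by (simp add: e mpow_mpow[OF h])
  then show ?thesis using H herm_mpow[OF h, of 2] unfolding contraction_def e by metis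
qed

lemma posf_scale:
  assumes "posf d S" "0 \<le> t"
  shows "posf d (mlin (\<lambda>_ _. 0) t S)"
proof -
  have "Re (\<Sum>i<d. \<Sum>j<d. cnj (v i) * mlin (\<lambda>_ _. 0) t S i j * v j)
      = t * Re (\<Sum>i<d. \<Sum>j<d. cnj (v i) * S i j * v j)" for v
  proof -
    have "(\<Sum>i<d. \<Sum>j<d. cnj (v i) * mlin (\<lambda>_ _. 0) t S i j * v j)
      = of_real t * (\<Sum>i<d. \<Sum>j<d. cnj (v i) * S i j * v j)"
      by (simp add: mlin_def sum_distrib_left algebra_simps)
    then show ?thesis by simp
  qed
  moreover have "herm d (mlin (\<lambda>_ _. 0) t S)"
    using assms by (auto simp: posf_def herm_def madj_mlin) (simp_all add: mlin_def madj_def)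
  ultimately show ?thesis using assms by (simp add: posf_def)
qed

lemma mtr_mlin0: "mtr d (mmul d A (mlin (\<lambda>_ _. 0) s S)) = s * mtr d (mmul d A S)"
  by (simp add: mmul_mlin_right mtr_mlin) (simp add: mtr_def mmul_def)

lemma posf_contraction_abs_le:
  assumes S: "posf d S" and H: "contraction d H"
  shows "\<bar>mtr d (mmul d H S)\<bar> \<le> mtr d S"
proof (cases "mtr d S = 0")
  case True
  have "herm d H" using H by (simp add: contraction_def)
  then have "(mtr d (mmul d H S))\<^sup>2 \<le> 0" using posf_mtr_mul_sq[OF S, of H] True by simp
  then show ?thesis using True by simp
next
  case False
  then have t: "mtr d S > 0" using posf_mtr_nn[OF S] by simp
  define R where "R = mlin (\<lambda>_ _. 0) (1 / mtr d S) S"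
  have "posf d R" unfolding R_def using S t by (intro posf_scale) auto
  moreover have "mtr d R = 1" using t by (simp add: R_def mtr_mlin) (simp add: mtr_def)
  ultimately have "\<bar>mtr d (mmul d H R)\<bar> \<le> 1" using state_contraction_abs_le H by blast
  then show ?thesis using t by (simp add: R_def mtr_mlin0 field_simps abs_divide)
qed

text \<open>\<open>X X\<close> acts as an unnormalised state and \<open>H H\<close> is again a
  contraction. Besides being Hermitian, this is all that the smoothness estimate uses of an
  effect.\<close>

lemma contraction_mtr_square_le:
  assumes "herm d X" "contraction d H"
  shows "mtr d (mmul d (mmul d X X) (mmul d H H)) \<le> mtr d (mmul d X X)"
  using posf_contraction_abs_le[OF posf_sq[OF assms(1)] contraction_square[OF assms(2)]]
  by (simp add: mtr_comm[of d "mmul d X X"])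

section \<open>Log-convexity of trace moments\<close>

lemma mtr_mpow_even_nonneg: "herm d C \<Longrightarrow> 0 \<le> mtr d (mpow d C (2 * k))"
  using mtr_sq_nonneg[OF herm_mpow, of d C k] by (simp add: mpow_square)

text \<open>A comparison of Schatten norms with exponents 2k and 2k + 2. Cauchy-Schwarz for C^k and
  C^(k+2) makes the even moments log-convex, and the zeroth moment is \<open>d\<close>.\<close>

lemma mtr_mpow_log_convex:
  assumes "herm d C"
  shows "mtr d (mpow d C (2 * k)) ^ Suc k \<le> real d * mtr d (mpow d C (2 * Suc k)) ^ k"
proof -
  define s where "s k = mtr d (mpow d C (2 * k))" for k
  have s0: "s k \<ge> 0" for k unfolding s_def using mtr_mpow_even_nonneg[OF assms] .
  have lc: "s (Suc k) ^ 2 \<le> s k * s (Suc (Suc k))" for k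
  proof -
    have "s (Suc k) = mtr d (mmul d (mpow d C k) (mpow d C (Suc (Suc k))))"
      unfolding s_def mpow_add[OF assms] by (simp add: mult_2)
    then show ?thesis unfolding s_def
      using mtr_Cauchy_Schwarz[OF herm_mpow[OF assms] herm_mpow[OF assms], of k "Suc (Suc k)"]
      by (simp only: mpow_square[OF assms])
  qed
  have "s k ^ Suc k \<le> s 0 * s (Suc k) ^ k"
  proof (induction k)
    case 0 show ?case by simp
  next
    case (Suc k)
    show ?case
    proof (cases "s (Suc k) = 0")
      case True then show ?thesis using s0 by simp
    next
      case False
      then have p: "s (Suc k) > 0" using s0[of "Suc k"] by simp
      \<comment> \<open>Multiplying the goal by \<open>s (Suc k) ^ k\<close> turns its left side
        into a power of the square that log-convexity bounds; the induction hypothesis then restores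
        the factor, which is cancelled.\<close>
      have "s (Suc k) ^ k * s (Suc k) ^ (Suc (Suc k)) = (s (Suc k) ^ 2) ^ Suc k"
        by (simp add: power_mult[symmetric] power_add[symmetric] mult_2[symmetric])
      also have "\<dots> \<le> (s k * s (Suc (Suc k))) ^ Suc k" using lc s0 by (intro power_mono) auto
      also have "\<dots> = s k ^ Suc k * s (Suc (Suc k)) ^ Suc k" by (rule power_mult_distrib)
      also have "\<dots> \<le> (s 0 * s (Suc k) ^ k) * s (Suc (Suc k)) ^ Suc k"
        using Suc.IH s0 by (intro mult_right_mono) auto
      finally have "s (Suc k) ^ k * s (Suc k) ^ (Suc (Suc k)) \<le> s (Suc k) ^ k * (s 0 * s (Suc (Suc k)) ^ Suc k)"
        by (simp only: ac_simps)
      then show ?thesis using p by (simp only: mult_le_cancel_left_pos zero_less_power)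
    qed
  qed
  then show ?thesis by (simp add: s_def mtr_mone)
qed

text \<open>A maximum principle. It is phrased with products instead of logarithms because values
  may vanish.\<close>

lemma log_convex_le_endpoints:
  fixes x :: "nat \<Rightarrow> real"
  assumes nn: "\<And>i. i \<le> N \<Longrightarrow> 0 \<le> x i"
    and lc: "\<And>i. 0 < i \<Longrightarrow> i < N \<Longrightarrow> (x i)\<^sup>2 \<le> x (i - 1) * x (i + 1)"
    and "x 0 \<le> M" "x N \<le> M" "i \<le> N"
  shows "x i \<le> M"
proof (rule ccontr)
  assume n: "\<not> x i \<le> M"
  define m where "m = Max (x ` {..N})"
  have mx: "x j \<le> m" if "j \<le> N" for j using that by (auto simp: m_def)
  have "m \<in> x ` {..N}" unfolding m_def by (intro Max_in) auto
  then obtain j0 where j0: "j0 \<le> N" "x j0 = m" by auto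
  \<comment> \<open>At the leftmost maximiser the left neighbour is strictly smaller, so the product
    of the neighbours is strictly below the squared maximum.\<close>
  define j where "j = (LEAST j. j \<le> N \<and> x j = m)"
  have j: "j \<le> N" "x j = m" using LeastI[of "\<lambda>j. j \<le> N \<and> x j = m" j0] j0 by (auto simp: j_def)
  have mM: "m > M" using n mx[OF assms(5)] by simp
  have jN: "0 < j" "j < N" using j mM assms(3,4) by (metis gr0I not_less, metis le_neq_implies_less not_less)
  have m0: "m > 0" using mM nn[of 0] assms(3) by simp
  have "x (j - 1) \<noteq> m"
  proof
    assume "x (j - 1) = m"
    then have "j \<le> j - 1" unfolding j_def by (intro Least_le) (use jN in \<open>auto simp: j_def\<close>)
    then show False using jN by simp
  qed
  then have "x (j - 1) < m" using mx[of "j - 1"] jN by linarith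
  moreover have "x (j + 1) \<le> m" "0 \<le> x (j + 1)" using jN mx nn by auto
  ultimately have "x (j - 1) * x (j + 1) \<le> x (j - 1) * m" "x (j - 1) * m < m * m"
    using m0 nn[of "j - 1"] jN by (auto intro!: mult_left_mono mult_strict_right_mono)
  then show False using lc[OF jN] j by (simp add: power2_eq_square)
qed

text \<open>For fixed a + b, the trace of C^a B C^b B is log-convex in a along even exponents, by
  Cauchy-Schwarz, and both endpoints equal the right side. Odd exponents lie between two even
  ones.\<close>

lemma mtr_sandwich_le:
  assumes C: "herm d C" and B: "herm d B" and ab: "a + b = 2 * N"
  shows "\<bar>mtr d (mmul d (mpow d C a) (mmul d B (mmul d (mpow d C b) B)))\<bar>
    \<le> mtr d (mmul d (mpow d C (2 * N)) (mmul d B B))" (is "_ \<le> ?M")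
proof -
  define F where "F a b = mtr d (mmul d (mpow d C a) (mmul d B (mmul d (mpow d C b) B)))" for a b
  note hp = herm_adj[OF herm_mpow[OF C]]
  define X where "X p q = mmul d (mpow d C p) (mmul d B (mpow d C q))" for p q
  \<comment> \<open>Any splitting of the two exponents exhibits \<open>F\<close> as the inner
    product of two matrices C^a B C^b, by cyclicity of the trace.\<close>
  have F: "F (a + a') (b + b') = mtr d (mmul d (X a b) (mmul d (mone d) (madj (X a' b'))))" for a b a' b'
  proof -
    have "mmul d (mone d) (madj (X a' b')) = mmul d (mpow d C b') (mmul d B (mpow d C a'))"
      unfolding X_def
      by (subst mone_mmul)
         (auto simp: madj_mmul hp herm_adj[OF B] mmul_assoc, simp add: mmul_def mpow_outside[OF C])
    then have "mtr d (mmul d (X a b) (mmul d (mone d) (madj (X a' b'))))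
      = mtr d (mmul d (mmul d (mpow d C a) (mmul d B (mmul d (mpow d C (b + b')) B))) (mpow d C a'))"
      by (simp add: X_def mmul_assoc mpow_add[OF C, symmetric])
    also have "\<dots> = mtr d (mmul d (mmul d (mpow d C a') (mpow d C a)) (mmul d B (mmul d (mpow d C (b + b')) B)))"
      by (subst mtr_comm) (simp add: mmul_assoc)
    finally show ?thesis by (simp add: F_def mpow_add[OF C] add.commute)
  qed
  have CS: "(F (p + r) (q + s))\<^sup>2 \<le> F (2 * p) (2 * q) * F (2 * r) (2 * s)" for p q r s
    using posf_Cauchy_Schwarz[OF posf_mone, of d "X p q" "X r s"] by (simp only: F mult_2)
  have Fnn: "0 \<le> F (2 * p) (2 * q)" for p q
    using posf_mtr_nonneg[OF posf_mone, of d "X p q"] by (simp only: F mult_2)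
  have FM: "F (2 * N) 0 = ?M" "F 0 (2 * N) = ?M"
  proof -
    show "F (2 * N) 0 = ?M" unfolding F_def using B by simp
    have "F 0 (2 * N) = mtr d (mmul d B (mmul d (mpow d C (2 * N)) B))"
      unfolding F_def by simp (subst mone_mmul, auto simp: mmul_def herm_outside[OF B])
    then show "F 0 (2 * N) = ?M" by (subst (asm) mtr_comm) (simp add: mmul_assoc)
  qed
  have ev: "F (2 * i) (2 * (N - i)) \<le> ?M" if "i \<le> N" for i
  proof (rule log_convex_le_endpoints[where N = N and x = "\<lambda>i. F (2 * i) (2 * (N - i))"])
    fix i assume i: "0 < i" "i < N"
    show "(F (2 * i) (2 * (N - i)))\<^sup>2 \<le> F (2 * (i - 1)) (2 * (N - (i - 1))) * F (2 * (i + 1)) (2 * (N - (i + 1)))"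
      using CS[of "i - 1" "i + 1" "N - (i - 1)" "N - (i + 1)"] i by (simp add: mult_2[of i] mult_2[of "N - i"])
  qed (use that FM Fnn in auto)
  have "\<bar>F a b\<bar> \<le> ?M"
  proof (cases "even a")
    case True
    then obtain i where i: "a = 2 * i" by auto
    then have "b = 2 * (N - i)" "i \<le> N" using ab by auto
    then show ?thesis using ev Fnn i by simp
  next
    case False
    then obtain i where i: "a = Suc (2 * i)" by (metis oddE Suc_eq_plus1)
    then have b: "b = (N - i) + (N - Suc i)" "Suc i \<le> N" using ab by auto
    \<comment> \<open>Cauchy-Schwarz bounds the odd exponent \<open>a\<close> by the geometric mean
      of its two even neighbours.\<close>
    have "(F a b)\<^sup>2 \<le> F (2 * i) (2 * (N - i)) * F (2 * Suc i) (2 * (N - Suc i))"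
      using CS[of i "Suc i" "N - i" "N - Suc i"] i b by (simp add: mult_2)
    also have "\<dots> \<le> ?M * ?M" using ev[of i] ev[of "Suc i"] b Fnn Fnn[of "Suc i"] FM(1) Fnn[of N 0]
      by (intro mult_mono) auto
    finally have "\<bar>F a b\<bar>\<^sup>2 \<le> ?M\<^sup>2" by (simp add: power2_eq_square)
    moreover have "0 \<le> ?M" using Fnn[of N 0] FM by simp
    ultimately show ?thesis by (rule power2_le_imp_le)
  qed
  then show ?thesis by (simp add: F_def)
qed

section \<open>Smoothness of the squared Schatten norm\<close>

primrec mpow_deriv :: "nat \<Rightarrow> (nat \<Rightarrow> nat \<Rightarrow> complex) \<Rightarrow> (nat \<Rightarrow> nat \<Rightarrow> complex) \<Rightarrow> nat \<Rightarrow> nat \<Rightarrow> nat \<Rightarrow> complex" where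
  "mpow_deriv d A B 0 = (\<lambda>_ _. 0)"
| "mpow_deriv d A B (Suc k) = (\<lambda>i j. mmul d B (mpow d A k) i j + mmul d A (mpow_deriv d A B k) i j)"

lemma mlin_has_vector_derivative:
  "((\<lambda>s. mlin A s B i j) has_vector_derivative B i j) (at s)"
proof -
  have "((\<lambda>s. of_real s * B i j) has_vector_derivative (1 * B i j)) (at s)"
    by (intro has_vector_derivative_mult_left) (auto intro!: derivative_eq_intros)
  then show ?thesis unfolding mlin_def by (auto intro!: derivative_eq_intros)
qed

lemma mpow_has_vector_derivative:
  "((\<lambda>s. mpow d (mlin A s B) k i j) has_vector_derivative mpow_deriv d (mlin A s B) B k i j) (at s)"
proof (induction k arbitrary: i j)
  case 0
  show ?case by simp
next
  case (Suc k)
  have "((\<lambda>s. \<Sum>l<d. mlin A s B i l * mpow d (mlin A s B) k l j) has_vector_derivative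
      (\<Sum>l<d. mlin A s B i l * mpow_deriv d (mlin A s B) B k l j + B i l * mpow d (mlin A s B) k l j)) (at s)"
    by (intro has_vector_derivative_sum has_vector_derivative_mult mlin_has_vector_derivative Suc)
  then show ?case by (simp add: mmul_def sum.distrib add.commute)
qed

lemma mtr_mpow_mmul_has_derivative:
  "((\<lambda>s. mtr d (mmul d (mpow d (mlin A s B) k) X)) has_real_derivative
     mtr d (mmul d (mpow_deriv d (mlin A s B) B k) X)) (at s)"
proof -
  have "((\<lambda>s. Re (\<Sum>i<d. \<Sum>l<d. mpow d (mlin A s B) k i l * X l i)) has_vector_derivative
     Re (\<Sum>i<d. \<Sum>l<d. mpow_deriv d (mlin A s B) B k i l * X l i)) (at s)"
    by (intro has_vector_derivative_sum has_vector_derivative_mult_left mpow_has_vector_derivative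
        bounded_linear.has_vector_derivative[OF bounded_linear_Re])
  then show ?thesis
    by (simp add: mtr_def mmul_def has_real_derivative_iff_has_vector_derivative)
qed

lemma mtr_add: "mtr d (\<lambda>i j. A i j + B i j) = mtr d A + mtr d B"
  by (simp add: mtr_def sum.distrib)

lemma mmul_add_left: "mmul d (\<lambda>i j. A i j + B i j) C = (\<lambda>i j. mmul d A C i j + mmul d B C i j)"
  by (simp add: mmul_def sum.distrib algebra_simps)

text \<open>The noncommutative product rule under the trace. \<open>X\<close> varies in the
  induction, because cyclicity moves the leading factor \<open>A\<close> behind it.\<close>

lemma mtr_mpow_deriv_mmul:
  assumes "herm d A"
  shows "mtr d (mmul d (mpow_deriv d A B k) X)
    = (\<Sum>a<k. mtr d (mmul d (mpow d A a) (mmul d B (mmul d (mpow d A (k - Suc a)) X))))"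
proof (induction k arbitrary: X)
  case 0
  show ?case by (simp add: mtr_def mmul_def)
next
  case (Suc k)
  have "mtr d (mmul d (mpow_deriv d A B (Suc k)) X)
    = mtr d (mmul d B (mmul d (mpow d A k) X)) + mtr d (mmul d (mpow_deriv d A B k) (mmul d X A))"
    by (simp add: mmul_add_left mtr_add mmul_assoc) (simp add: mtr_comm[of d A] mmul_assoc)
  also have "mtr d (mmul d B (mmul d (mpow d A k) X)) 
     = mtr d (mmul d (mpow d A 0) (mmul d B (mmul d (mpow d A k) X)))"
    by (simp add: mtr_def mmul_def mone_def if_distrib[of "\<lambda>x. x * _"] sum.delta cong: if_cong conj_cong)
  also have "mtr d (mmul d (mpow_deriv d A B k) (mmul d X A))
     = (\<Sum>a<k. mtr d (mmul d (mpow d A (Suc a)) (mmul d B (mmul d (mpow d A (k - Suc a)) X))))"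
    unfolding Suc.IH
  proof (intro sum.cong refl)
    fix a
    have "mtr d (mmul d (mpow d A a) (mmul d B (mmul d (mpow d A (k - Suc a)) (mmul d X A))))
       = mtr d (mmul d (mmul d (mpow d A a) (mmul d B (mmul d (mpow d A (k - Suc a)) X))) A)"
      by (simp add: mmul_assoc)
    also have "\<dots> = mtr d (mmul d A (mmul d (mpow d A a) (mmul d B (mmul d (mpow d A (k - Suc a)) X))))"
      by (rule mtr_comm)
    finally show "mtr d (mmul d (mpow d A a) (mmul d B (mmul d (mpow d A (k - Suc a)) (mmul d X A))))
       = mtr d (mmul d (mpow d A (Suc a)) (mmul d B (mmul d (mpow d A (k - Suc a)) X)))"
      by (simp add: mmul_assoc)
  qed
  finally show ?case by (simp only: sum.lessThan_Suc_shift diff_Suc_Suc diff_zero)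
qed

text \<open>By cyclicity all summands of the product rule coincide.\<close>

lemma mtr_mpow_deriv:
  assumes "herm d A" "herm d B"
  shows "mtr d (mmul d (mpow_deriv d A B (Suc k)) (mone d)) = real (Suc k) * mtr d (mmul d (mpow d A k) B)"
proof -
  have "mtr d (mmul d (mpow d A a) (mmul d B (mmul d (mpow d A (Suc k - Suc a)) (mone d))))
      = mtr d (mmul d (mpow d A k) B)" if "a < Suc k" for a
  proof -
    have "mtr d (mmul d (mpow d A a) (mmul d B (mmul d (mpow d A (Suc k - Suc a)) (mone d))))
      = mtr d (mmul d (mmul d (mpow d A a) B) (mpow d A (k - a)))"
      by (simp add: herm_mpow[OF assms(1)] mmul_assoc)
    also have "\<dots> = mtr d (mmul d (mmul d (mpow d A (k - a)) (mpow d A a)) B)"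
      by (subst mtr_comm) (simp add: mmul_assoc)
    finally show ?thesis using that by (simp add: mpow_add[OF assms(1)])
  qed
  then show ?thesis unfolding mtr_mpow_deriv_mmul[OF assms(1)] by simp
qed

section \<open>Second-order bound for the potential\<close>

text \<open>The summand \<open>1\<close> keeps the \<open>q\<close>-th root smooth at \<open>A = 0\<close>. Below, \<open>gradient d q A H\<close> is half the
  derivative of \<open>pot d q A powr (2 / q)\<close> in direction \<open>H\<close>.\<close>

definition pot :: "nat \<Rightarrow> nat \<Rightarrow> (nat \<Rightarrow> nat \<Rightarrow> complex) \<Rightarrow> real" where
  "pot d q A = 1 + mtr d (mpow d A q)"

definition gradient :: "nat \<Rightarrow> nat \<Rightarrow> (nat \<Rightarrow> nat \<Rightarrow> complex) \<Rightarrow> (nat \<Rightarrow> nat \<Rightarrow> complex) \<Rightarrow> real" where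
  "gradient d q A H = pot d q A powr (2 / real q - 1) * mtr d (mmul d (mpow d A (q - 1)) H)"

lemma pot_ge_1: "herm d A \<Longrightarrow> even q \<Longrightarrow> 1 \<le> pot d q A"
  using mtr_mpow_even_nonneg[of d A "q div 2"] by (simp add: pot_def)

lemma power_powr_inverse:
  fixes x :: real
  assumes "0 \<le> x" "0 < k" shows "(x ^ k) powr (1 / real k) = x"
proof (cases "x = 0")
  case False
  then have "x ^ k = x powr real k" using assms by (simp add: powr_realpow)
  then show ?thesis using assms by (simp add: powr_powr)
qed (use assms in simp)

text \<open>With q = 2(k + 1), this is the (k + 1)-th root of the moment comparison. The dimension
  enters only as d^(2/q), a constant once q is at least log d to base 2.\<close>

lemma mtr_mpow_pred_le:
  assumes C: "herm d C" and q: "even q" "q \<ge> 2" and dq: "real d powr (2 / real q) \<le> 4"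
  shows "mtr d (mpow d C (q - 2)) \<le> 4 * pot d q C powr (1 - 2 / real q)"
proof -
  obtain k where k: "q = 2 * Suc k" using q by (metis evenE mult_0_right not_numeral_le_zero old.nat.exhaust)
  have e: "1 / real (Suc k) = 2 / real q" using k by (simp add: field_simps)
  let ?a = "mtr d (mpow d C (2 * k))" and ?b = "mtr d (mpow d C (2 * Suc k))"
  have nn: "0 \<le> ?a" "0 \<le> ?b" using mtr_mpow_even_nonneg[OF C] by blast+
  have "?a = (?a ^ Suc k) powr (1 / real (Suc k))" using nn by (intro power_powr_inverse[symmetric]) auto
  also have "\<dots> \<le> (real d * ?b ^ k) powr (1 / real (Suc k))"
    using mtr_mpow_log_convex[OF C] nn by (intro powr_mono2) auto
  also have "\<dots> \<le> (real d * pot d q C ^ k) powr (1 / real (Suc k))"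
    using nn k by (intro powr_mono2 mult_left_mono power_mono) (auto simp: pot_def simp del: mpow.simps mult_Suc_right)
  also have "\<dots> = real d powr (2 / real q) * pot d q C powr (real k * (1 / real (Suc k)))"
    using pot_ge_1[OF C q(1)] unfolding e[symmetric] by (simp add: powr_mult powr_powr flip: powr_realpow)
  also have "real k * (1 / real (Suc k)) = 1 - 2 / real q" using k by (simp add: field_simps)
  also have "real d powr (2 / real q) * pot d q C powr (1 - 2 / real q) \<le> 4 * pot d q C powr (1 - 2 / real q)"
    using dq by (intro mult_right_mono) auto
  finally show ?thesis using k by simp
qed

text \<open>Each of the q - 1 product rule terms has exponents adding up to q - 2. The sandwich
  bound brings both factors \<open>B\<close> together, \<open>BB\<close> removes them, and a moment
  of order q - 2 remains.\<close>

lemma pot_second_derivative_le: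
  assumes C: "herm d C" and B: "herm d B" and q: "even q" "q \<ge> 2" and dq: "real d powr (2 / real q) \<le> 4"
    and BB: "\<And>X. herm d X \<Longrightarrow> mtr d (mmul d (mmul d X X) (mmul d B B)) \<le> mtr d (mmul d X X)"
  shows "mtr d (mmul d (mpow_deriv d C B (q - 1)) B) \<le> 4 * real (q - 1) * pot d q C powr (1 - 2 / real q)"
proof -
  have "mtr d (mmul d (mpow_deriv d C B (q - 1)) B)
    \<le> (\<Sum>a<q - 1. mtr d (mmul d (mpow d C (q - 2)) (mmul d B B)))"
    unfolding mtr_mpow_deriv_mmul[OF C]
  proof (intro sum_mono)
    fix a assume "a \<in> {..<q - 1}"
    then have "a + (q - 1 - Suc a) = 2 * ((q - 2) div 2)" "2 * ((q - 2) div 2) = q - 2" using q by auto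
    from mtr_sandwich_le[OF C B this(1)] this(2)
    show "mtr d (mmul d (mpow d C a) (mmul d B (mmul d (mpow d C (q - 1 - Suc a)) B)))
      \<le> mtr d (mmul d (mpow d C (q - 2)) (mmul d B B))" by simp
  qed
  also have "\<dots> \<le> (\<Sum>a<q - 1. mtr d (mpow d C (q - 2)))"
  proof (intro sum_mono)
    have e: "mmul d (mpow d C ((q - 2) div 2)) (mpow d C ((q - 2) div 2)) = mpow d C (q - 2)"
      using q by (simp add: mpow_square[OF C])
    show "mtr d (mmul d (mpow d C (q - 2)) (mmul d B B)) \<le> mtr d (mpow d C (q - 2))"
      using BB[OF herm_mpow[OF C, of "(q - 2) div 2"]] unfolding e .
  qed
  also have "\<dots> = real (q - 1) * mtr d (mpow d C (q - 2))" by simp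
  also have "\<dots> \<le> real (q - 1) * (4 * pot d q C powr (1 - 2 / real q))"
    by (intro mult_left_mono mtr_mpow_pred_le C q dq) simp
  finally show ?thesis by simp
qed

text \<open>Taylor expansion to second order along A + sB: the linear term is the gradient, and the
  second derivative is bounded by 8q uniformly on the segment.\<close>

lemma pot_step:
  assumes A: "herm d A" and B: "herm d B" and q: "even q" "q \<ge> 2" and dq: "real d powr (2 / real q) \<le> 4"
    and BB: "\<And>X. herm d X \<Longrightarrow> mtr d (mmul d (mmul d X X) (mmul d B B)) \<le> mtr d (mmul d X X)"
  shows "pot d q (mlin A 1 B) powr (2 / real q)
    \<le> pot d q A powr (2 / real q) + 2 * gradient d q A B + 4 * real q"
proof -
  define p where "p = 2 / real q"
  have p: "0 < p" "p \<le> 1" "real q * p = 2" using q by (auto simp: p_def)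
  define \<psi> where "\<psi> s = pot d q (mlin A s B)" for s
  define \<psi>1 where "\<psi>1 s = real q * mtr d (mmul d (mpow d (mlin A s B) (q - 1)) B)" for s
  define \<psi>2 where "\<psi>2 s = real q * mtr d (mmul d (mpow_deriv d (mlin A s B) B (q - 1)) B)" for s
  have C: "herm d (mlin A s B)" for s by (intro herm_mlin A B)
  have qs: "Suc (q - 1) = q" using q by simp
  have pos: "\<psi> s > 0" for s using pot_ge_1[OF C q(1)] unfolding \<psi>_def by (rule order.strict_trans2[rotated]) simp
  have d1: "(\<psi> has_real_derivative \<psi>1 s) (at s)" for s
  proof -
    have "((\<lambda>s. 1 + mtr d (mmul d (mpow d (mlin A s B) q) (mone d))) has_real_derivative 0 + \<psi>1 s) (at s)"
      using mtr_mpow_mmul_has_derivative[of d A B q "mone d" s] mtr_mpow_deriv[OF C B, of s "q - 1"]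
      unfolding qs \<psi>1_def by (intro DERIV_add) auto
    then show ?thesis unfolding \<psi>_def pot_def using herm_mpow[OF C] by simp
  qed
  have d2: "(\<psi>1 has_real_derivative \<psi>2 s) (at s)" for s
    unfolding \<psi>1_def \<psi>2_def by (intro DERIV_cmult mtr_mpow_mmul_has_derivative)
  define f where "f s = \<psi> s powr p" for s
  define f1 where "f1 s = p * \<psi> s powr (p - 1) * \<psi>1 s" for s
  define f2 where "f2 s = p * (p - 1) * \<psi> s powr (p - 2) * (\<psi>1 s)\<^sup>2 + p * \<psi> s powr (p - 1) * \<psi>2 s" for s
  have e1: "(f has_real_derivative f1 s) (at s)" for s
    unfolding f_def f1_def using pos by (auto intro!: derivative_eq_intros d1)
  have e2: "(f1 has_real_derivative f2 s) (at s)" for s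
    unfolding f2_def f1_def using pos
    by (auto intro!: derivative_eq_intros d1 d2 simp: power2_eq_square algebra_simps)
  have f2: "f2 s \<le> 8 * real q" for s
  proof -
    \<comment> \<open>The outer power has exponent \<open>p\<close> at most 1 and is concave, so
      this term only helps an upper bound.\<close>
    have neg: "p * (p - 1) * \<psi> s powr (p - 2) * (\<psi>1 s)\<^sup>2 \<le> 0"
      using p by (intro mult_nonpos_nonneg mult_nonneg_nonpos) auto
    have "\<psi>2 s \<le> real q * (4 * real (q - 1) * \<psi> s powr (1 - p))"
      unfolding \<psi>2_def \<psi>_def p_def
      by (intro mult_left_mono pot_second_derivative_le C B q dq BB) auto
    then have "p * \<psi> s powr (p - 1) * \<psi>2 s \<le> p * \<psi> s powr (p - 1) * (real q * (4 * real (q - 1) * \<psi> s powr (1 - p)))"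
      using p by (intro mult_left_mono) auto
    also have "\<dots> = (real q * p) * 4 * real (q - 1) * (\<psi> s powr (p - 1) * \<psi> s powr (1 - p))"
      by (simp only: ac_simps)
    \<comment> \<open>The power from differentiating the root cancels the power in the moment bound,
      which makes the estimate independent of \<open>A\<close>.\<close>
    also have "\<psi> s powr (p - 1) * \<psi> s powr (1 - p) = 1"
      using pos[of s] by (simp flip: powr_add)
    also have "(real q * p) * 4 * real (q - 1) * 1 \<le> 8 * real q" unfolding p by simp
    finally show ?thesis using neg unfolding f2_def by linarith
  qed
  define D where "D m = (if m = 0 then f else if m = (1::nat) then f1 else f2)" for m
  have "\<exists>t>0. t < 1 \<and> f 1 = (\<Sum>m<2. D m 0 / fact m * 1 ^ m) + D 2 t / fact 2 * 1 ^ 2"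
    by (rule Maclaurin) (auto simp: D_def e1 e2 less_2_cases_iff)
  then obtain t where "f 1 = f 0 + f1 0 + f2 t / 2" by (auto simp: D_def numeral_2_eq_2)
  then have "f 1 \<le> f 0 + f1 0 + 4 * real q" using f2[of t] by simp
  moreover have "f1 0 = 2 * gradient d q A B"
  proof -
    have "f1 0 = (real q * p) * gradient d q (mlin A 0 B) B"
      unfolding f1_def gradient_def \<psi>1_def \<psi>_def p_def by simp
    then show ?thesis unfolding p by (simp add: mlin_def)
  qed
  ultimately show ?thesis by (simp add: f_def \<psi>_def p_def mlin_def)
qed

section \<open>Covering states by signed sums of effects\<close>

primrec signed_sum :: "('i \<Rightarrow> nat \<Rightarrow> nat \<Rightarrow> complex) \<Rightarrow> ('i \<times> bool) list \<Rightarrow> nat \<Rightarrow> nat \<Rightarrow> complex" where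
  "signed_sum H [] = (\<lambda>_ _. 0)"
| "signed_sum H (x # xs) = mlin (signed_sum H xs) (if snd x then 1 else - 1) (H (fst x))"

lemma herm_zero: "herm d (\<lambda>_ _. 0)" by (simp add: herm_def madj_def)

lemma herm_signed_sum:
  "(\<And>i. i \<in> fst ` set xs \<Longrightarrow> herm d (H i)) \<Longrightarrow> herm d (signed_sum H xs)"
  by (induction xs) (auto simp: herm_zero intro!: herm_mlin)

lemma mlin_mlin0: "mlin A 1 (mlin (\<lambda>_ _. 0) s B) = mlin A s B"
  by (simp add: mlin_def)

lemma gradient_mlin0: "gradient d q A (mlin (\<lambda>_ _. 0) s B) = s * gradient d q A B"
  by (simp add: gradient_def mtr_mlin0)

lemma mmul_mlin0_square:
  "\<bar>s\<bar> = 1 \<Longrightarrow> mmul d (mlin (\<lambda>_ _. 0) s B) (mlin (\<lambda>_ _. 0) s B) = mmul d B B"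
proof -
  assume "\<bar>s\<bar> = 1"
  then have "complex_of_real s * of_real s = 1" by (auto simp: abs_if split: if_splits simp flip: of_real_mult)
  then have "of_real s * x * (of_real s * y) = x * y" for x y :: complex by (metis mult.assoc mult.commute mult_1)
  then show ?thesis by (simp only: mmul_def mlin_def add_0)
qed

lemma pot_signed_step:
  assumes A: "herm d A" and H: "contraction d H" and q: "even q" "q \<ge> 2" and dq: "real d powr (2 / real q) \<le> 4"
    and s: "\<bar>s\<bar> = 1"
  shows "pot d q (mlin A s H) powr (2 / real q)
    \<le> pot d q A powr (2 / real q) + 2 * (s * gradient d q A H) + 4 * real q"
proof -
  let ?B = "mlin (\<lambda>_ _. 0) s H"
  have "herm d H" using H by (simp add: contraction_def)
  then have B: "herm d ?B" by (intro herm_mlin herm_zero)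
  show ?thesis
    using pot_step[OF A B q dq] contraction_mtr_square_le[OF _ H]
    by (simp add: mlin_mlin0 gradient_mlin0 mmul_mlin0_square[OF s])
qed

lemma state_le_pot:
  assumes S: "posf d S" "mtr d S = 1" and A: "herm d A" and q: "q = 2 ^ r" "r \<ge> 1"
  shows "mtr d (mmul d A S) \<le> pot d q A powr (1 / real q)"
proof -
  let ?x = "\<bar>mtr d (mmul d A S)\<bar>"
  have q0: "q > 0" using q by simp
  have "?x = (?x ^ q) powr (1 / real q)" using q0 by (intro power_powr_inverse[symmetric]) auto
  also have "\<dots> \<le> pot d q A powr (1 / real q)"
    using state_mtr_power_le[OF S A q(2)] by (intro powr_mono2) (auto simp: pot_def q(1))
  finally show ?thesis by linarith
qed

text \<open>The correction algorithm as an argument by contradiction. If every admissible list errs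
  somewhere, it can be extended with the invariant \<open>P\<close> preserved; but the potential
  bounds the length of every list that satisfies \<open>P\<close>.\<close>

lemma signed_sum_cover:
  assumes S: "posf d S" "mtr d S = 1"
    and H: "\<And>i. i \<in> I \<Longrightarrow> contraction d (H i)"
    and q: "q = 2 ^ r" "r \<ge> 1" and dq: "real d powr (2 / real q) \<le> 4" and \<alpha>: "\<alpha> > 0"
  shows "\<exists>xs. set xs \<subseteq> I \<times> UNIV \<and> real (length xs) \<le> 1 + 4 * real q / \<alpha>\<^sup>2 \<and>
    (\<forall>i\<in>I. \<bar>\<alpha> / (4 * real q) * gradient d q (signed_sum H xs) (H i) - mtr d (mmul d (H i) S)\<bar> \<le> \<alpha>)"
proof (rule ccontr)
  assume neg: "\<not> ?thesis"
  \<comment> \<open>With this step size a correction gains 2 \<alpha> / l = 8q, twice the smoothness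
    cost 4q.\<close>
  define l where "l = \<alpha> / (4 * real q)"
  define V where "V A = pot d q A powr (2 / real q)" for A
  define h where "h A = mtr d (mmul d A S)" for A
  obtain r' where "r = Suc r'" using q(2) by (cases r) auto
  then have q2: "even q" "q \<ge> 2" by (simp_all add: q(1))
  then have q0: "real q > 0" by simp
  have l: "l > 0" using \<alpha> q0 by (simp add: l_def)
  have herm: "herm d (signed_sum H xs)" if "set xs \<subseteq> I \<times> UNIV" for xs
    using that H by (intro herm_signed_sum) (auto simp: contraction_def)
  \<comment> \<open>The accumulated potential estimate: the 1 is the potential of the zero matrix,
    and each correction adds 4q plus 2 / l times the signed true value minus \<alpha>.\<close>
  define P where "P xs \<longleftrightarrow> set xs \<subseteq> I \<times> UNIV \<and>
    V (signed_sum H xs) \<le> 1 + 2 / l * (h (signed_sum H xs) - \<alpha> * real (length xs)) + 4 * real q * real (length xs)" for xs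
  have bound: "real (length xs) \<le> 1 + 4 * real q / \<alpha>\<^sup>2" if "P xs" for xs
  proof -
    let ?A = "signed_sum H xs" and ?n = "real (length xs)"
    define u where "u = pot d q ?A powr (1 / real q)"
    have hA: "herm d ?A" using that herm by (simp add: P_def)
    have "V ?A = u\<^sup>2" using pot_ge_1[OF hA q2(1)] unfolding V_def u_def by (simp add: powr_powr flip: powr_realpow)
    moreover have "h ?A \<le> u" unfolding h_def u_def by (rule state_le_pot[OF S hA q])
    then have "2 / l * h ?A \<le> 2 / l * u" using l by (intro mult_left_mono) auto
    ultimately have "u\<^sup>2 \<le> 1 + 2 / l * u - 2 / l * \<alpha> * ?n + 4 * real q * ?n"
      using that by (simp add: P_def algebra_simps)
    \<comment> \<open>Completing the square eliminates the unknown norm \<open>u\<close> and leaves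
      4qn \<le> 1 + 1 / l^2 for the length n.\<close>
    moreover have "u\<^sup>2 - 2 / l * u + (1 / l)\<^sup>2 = (u - 1 / l)\<^sup>2" by (simp add: power2_diff)
    moreover have "0 \<le> (u - 1 / l)\<^sup>2" by simp
    moreover have "2 / l * \<alpha> = 8 * real q" using \<alpha> q0 by (simp add: l_def)
    then have "2 / l * \<alpha> * ?n = 2 * (4 * real q * ?n)" by simp
    ultimately have "4 * real q * ?n \<le> 1 + (1 / l)\<^sup>2" by linarith
    also have "\<dots> = 1 + 4 * real q * (4 * real q / \<alpha>\<^sup>2)" by (simp add: l_def power2_eq_square)
    also have "\<dots> \<le> 4 * real q * (1 + 4 * real q / \<alpha>\<^sup>2)" using q2 by (simp add: algebra_simps)
    finally show ?thesis by (rule mult_left_le_imp_le) (use q0 in simp)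
  qed
  have ext: "\<exists>ys. P ys \<and> length ys = Suc (length xs)" if "P xs" for xs
  proof -
    let ?A = "signed_sum H xs"
    have xs: "set xs \<subseteq> I \<times> UNIV" using that by (simp add: P_def)
    \<comment> \<open>Since \<open>bound\<close> keeps \<open>xs\<close> within the length limit,
      \<open>neg\<close> forces a wrong prediction.\<close>
    obtain i where i: "i \<in> I" "\<not> \<bar>l * gradient d q ?A (H i) - h (H i)\<bar> \<le> \<alpha>"
      using neg xs bound[OF \<open>P xs\<close>] unfolding l_def h_def by blast
    \<comment> \<open>The sign is positive exactly when the prediction is too small, so the signed
      prediction falls short of the signed true value by more than \<alpha>.\<close>
    define s :: bool where "s \<longleftrightarrow> l * gradient d q ?A (H i) < h (H i)"
    define t :: real where "t = (if s then 1 else - 1)"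
    have "t * (l * gradient d q ?A (H i)) \<le> t * h (H i) - \<alpha>"
      using i(2) by (auto simp: t_def s_def)
    then have g: "2 * (t * gradient d q ?A (H i)) \<le> 2 / l * (t * h (H i) - \<alpha>)"
      using l by (simp add: field_simps)
    have "V (mlin ?A t (H i)) \<le> V ?A + 2 * (t * gradient d q ?A (H i)) + 4 * real q"
      unfolding V_def by (rule pot_signed_step[OF herm[OF xs] H[OF i(1)] q2 dq]) (simp add: t_def)
    moreover have "h (mlin ?A t (H i)) = h ?A + t * h (H i)"
      by (simp add: h_def mmul_mlin_left mtr_mlin)
    ultimately have "P ((i, s) # xs)"
      using that g i(1) by (simp add: P_def t_def[symmetric] algebra_simps)
    then show ?thesis by force
  qed
  have "\<exists>xs. P xs \<and> length xs = n" for n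
  proof (induction n)
    case 0
    have "mpow d (\<lambda>_ _. 0) q = (\<lambda>_ _. 0)" using q2 by (cases q) (simp_all add: mmul_def)
    then have "P []" by (simp add: P_def V_def pot_def h_def mtr_def mmul_def)
    then show ?case by auto
  next
    case (Suc n) then show ?case using ext by metis
  qed
  then obtain xs where "P xs" "length xs = Suc (nat \<lceil>1 + 4 * real q / \<alpha>\<^sup>2\<rceil>)" by blast
  then have "real (length xs) = 1 + real (nat \<lceil>1 + 4 * real q / \<alpha>\<^sup>2\<rceil>)" by simp
  then show False
    using bound[OF \<open>P xs\<close>] real_nat_ceiling_ge[of "1 + 4 * real q / \<alpha>\<^sup>2"] by linarith
qed

section \<open>Matrices of states and effects\<close>

definition fmat :: "nat \<Rightarrow> complex mat \<Rightarrow> nat \<Rightarrow> nat \<Rightarrow> complex" where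
  "fmat d A = (\<lambda>i j. if i < d \<and> j < d then A $$ (i, j) else 0)"

definition obs :: "nat \<Rightarrow> complex mat \<Rightarrow> nat \<Rightarrow> nat \<Rightarrow> complex" where
  "obs d E = (\<lambda>i j. 2 * fmat d E i j - mone d i j)"

lemma herm_fmat: "hermitian_mat d A \<Longrightarrow> herm d (fmat d A)"
proof -
  assume A: "hermitian_mat d A"
  have "cnj (A $$ (j, i)) = A $$ (i, j)" if "i < d" "j < d" for i j
    using A that by (metis hermitian_mat_def)
  then show ?thesis by (auto simp: herm_def madj_def fmat_def fun_eq_iff)
qed

lemma herm_obs: "hermitian_mat d E \<Longrightarrow> herm d (obs d E)"
  using herm_fmat[of d E] herm_mone[of d]
  by (auto simp: herm_def obs_def madj_def fun_eq_iff)

lemma mtr_obs: "mtr d (mmul d (obs d E) S) = 2 * mtr d (mmul d (fmat d E) S) - mtr d (mmul d (mone d) S)"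
proof -
  have "obs d E = mlin (mlin (\<lambda>_ _. 0) 2 (fmat d E)) (- 1) (mone d)" by (simp add: obs_def mlin_def)
  moreover have "mtr d (mmul d (\<lambda>_ _. 0) S) = 0" by (simp add: mtr_def mmul_def)
  ultimately show ?thesis by (simp add: mmul_mlin_left mtr_mlin)
qed

lemma posf_fmat: "psd_mat d A \<Longrightarrow> posf d (fmat d A)"
proof -
  assume A: "psd_mat d A"
  have "0 \<le> Re (\<Sum>i<d. \<Sum>j<d. cnj (v i) * fmat d A i j * v j)" for v
  proof -
    have "0 \<le> Re (\<Sum>i<d. \<Sum>j<d. cnj (vec d v $ i) * A $$ (i, j) * vec d v $ j)"
      using A unfolding psd_mat_def by (meson vec_carrier)
    also have "(\<Sum>i<d. \<Sum>j<d. cnj (vec d v $ i) * A $$ (i, j) * vec d v $ j)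
      = (\<Sum>i<d. \<Sum>j<d. cnj (v i) * fmat d A i j * v j)"
      by (intro sum.cong refl) (simp add: fmat_def)
    finally show ?thesis .
  qed
  then show ?thesis using A herm_fmat by (simp add: posf_def psd_mat_def)
qed

lemma qstate_posf:
  assumes "qstate n \<rho>" shows "posf (2 ^ n) (fmat (2 ^ n) \<rho>)" "mtr (2 ^ n) (fmat (2 ^ n) \<rho>) = 1"
proof -
  show "posf (2 ^ n) (fmat (2 ^ n) \<rho>)" using assms posf_fmat by (simp add: qstate_def)
  have "dim_row \<rho> = 2 ^ n" using assms by (auto simp: qstate_def psd_mat_def hermitian_mat_def)
  then have "(\<Sum>i<2 ^ n. fmat (2 ^ n) \<rho> i i) = 1" using assms by (simp add: qstate_def mtrace_def fmat_def)
  then show "mtr (2 ^ n) (fmat (2 ^ n) \<rho>) = 1" by (simp add: mtr_def)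
qed

lemma fmat_mult:
  assumes "A \<in> carrier_mat d d" "B \<in> carrier_mat d d"
  shows "fmat d (A * B) = mmul d (fmat d A) (fmat d B)"
  using assms by (auto simp: fmat_def mmul_def fun_eq_iff scalar_prod_def atLeast0LessThan)

lemma mtr_fmat: "A \<in> carrier_mat d d \<Longrightarrow> mtr d (fmat d A) = Re (mtrace A)"
  by (simp add: mtr_def mtrace_def fmat_def)

text \<open>Acceptance values are therefore real, and the modulus in \<open>good\<close> is an
  absolute value of reals.\<close>

lemma Im_mtrace_mult:
  assumes "hermitian_mat d A" "hermitian_mat d B"
  shows "Im (mtrace (A * B)) = 0"
proof -
  have c: "A \<in> carrier_mat d d" "B \<in> carrier_mat d d" using assms by (auto simp: hermitian_mat_def)
  have e: "mtrace (A * B) = (\<Sum>i<d. \<Sum>k<d. A $$ (i, k) * B $$ (k, i))"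
    using c by (simp add: mtrace_def scalar_prod_def atLeast0LessThan)
  have "cnj (mtrace (A * B)) = (\<Sum>i<d. \<Sum>k<d. A $$ (k, i) * B $$ (i, k))"
  proof -
    have "cnj (A $$ (i, k)) = A $$ (k, i)" "cnj (B $$ (k, i)) = B $$ (i, k)" if "i < d" "k < d" for i k
      using assms that by (metis hermitian_mat_def)+
    then show ?thesis unfolding e cnj_sum complex_cnj_mult by (intro sum.cong refl) auto
  qed
  also have "\<dots> = mtrace (A * B)" unfolding e by (rule sum.swap)
  finally show ?thesis by (simp add: complex_eq_iff)
qed

text \<open>The identity part of 2E - 1 contributes trace 1 for either state and cancels, which
  leaves the factor 2.\<close>

lemma cmod_acc_diff:
  assumes E: "hermitian_mat (2 ^ n) E" and "qstate n \<sigma>" "qstate n \<rho>"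
  shows "2 * cmod (acc E \<sigma> - acc E \<rho>) =
    \<bar>mtr (2 ^ n) (mmul (2 ^ n) (obs (2 ^ n) E) (fmat (2 ^ n) \<sigma>)) -
     mtr (2 ^ n) (mmul (2 ^ n) (obs (2 ^ n) E) (fmat (2 ^ n) \<rho>))\<bar>"
proof -
  have h: "hermitian_mat (2 ^ n) \<sigma>" "hermitian_mat (2 ^ n) \<rho>"
    using assms by (auto simp: qstate_def psd_mat_def)
  then have c: "\<sigma> \<in> carrier_mat (2 ^ n) (2 ^ n)" "\<rho> \<in> carrier_mat (2 ^ n) (2 ^ n)" "E \<in> carrier_mat (2 ^ n) (2 ^ n)"
    using E by (auto simp: hermitian_mat_def)
  have "Im (acc E \<sigma> - acc E \<rho>) = 0" using Im_mtrace_mult[OF E] h by (simp add: acc_def)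
  then have "cmod (acc E \<sigma> - acc E \<rho>) = \<bar>Re (acc E \<sigma>) - Re (acc E \<rho>)\<bar>"
    by (simp add: cmod_eq_Re)
  then show ?thesis
    using c h qstate_posf(2)[OF assms(2)] qstate_posf(2)[OF assms(3)]
    by (simp add: mtr_obs herm_fmat mtr_fmat acc_def abs_if flip: fmat_mult)
qed

section \<open>From the spectrum of an effect to its power moments\<close>

lemma mtrace_mult_comm:
  assumes "A \<in> carrier_mat d d" "B \<in> carrier_mat d d"
  shows "mtrace (A * B) = mtrace (B * A)"
proof -
  have "mtrace (X * Y) = (\<Sum>i<d. \<Sum>k<d. X $$ (i, k) * Y $$ (k, i))" if "X \<in> carrier_mat d d" "Y \<in> carrier_mat d d" for X Y
    using that by (simp add: mtrace_def scalar_prod_def atLeast0LessThan)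
  then show ?thesis using assms by (simp, subst sum.swap) (simp add: mult.commute)
qed

lemma upper_triangular_pow_entries:
  fixes T :: "complex mat"
  assumes T: "T \<in> carrier_mat d d" "upper_triangular T" and "i < d" "j \<le> i"
  shows "(T ^\<^sub>m k) $$ (i, j) = (if i = j then (T $$ (i, i)) ^ k else 0)"
  using assms(3,4)
proof (induction k arbitrary: i j)
  case 0
  then show ?case using T by simp
next
  case (Suc k)
  have c: "T ^\<^sub>m k \<in> carrier_mat d d" using T by simp
  have z: "T $$ (l, j) = 0" if "j < l" "l < d" for l using T that by auto
  have "(T ^\<^sub>m Suc k) $$ (i, j) = (\<Sum>l<d. (T ^\<^sub>m k) $$ (i, l) * T $$ (l, j))"
    using T c Suc.prems by (simp add: scalar_prod_def atLeast0LessThan)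
  also have "\<dots> = (\<Sum>l<d. if l = i then T $$ (i, i) ^ k * T $$ (i, j) else 0)"
  proof (intro sum.cong refl)
    fix l assume "l \<in> {..<d}"
    then show "(T ^\<^sub>m k) $$ (i, l) * T $$ (l, j) = (if l = i then T $$ (i, i) ^ k * T $$ (i, j) else 0)"
      using Suc.IH[of i l] Suc.prems z[of l] by (cases "l \<le> i") auto
  qed
  also have "\<dots> = T $$ (i, i) ^ k * T $$ (i, j)" using Suc.prems by simp
  finally show ?case using Suc.prems z[of i] by auto
qed

text \<open>The matrix is 2A - 1. Schur triangularisation suffices: powers of a triangular matrix
  have the powers of its diagonal on their diagonal, and the trace is invariant under
  similarity.\<close>

lemma mtrace_pow_spectrum:
  fixes A :: "complex mat"
  assumes A: "A \<in> carrier_mat d d"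
  shows "\<exists>t. (\<forall>i<d. eigenvalue A (t i)) \<and>
    (\<forall>k. mtrace ((2 \<cdot>\<^sub>m char_matrix A (1 / 2)) ^\<^sub>m k) = (\<Sum>i<d. (2 * t i - 1) ^ k))"
proof -
  obtain es where es: "char_poly A = (\<Prod>a\<leftarrow>es. [:- a, 1:])" using char_poly_factorized[OF A] by blast
  obtain T P Q where TPQ: "schur_decomposition A es = (T, P, Q)" by (cases "schur_decomposition A es") auto
  from schur_decomposition[OF A es TPQ]
  have sim: "similar_mat_wit A T P Q" and ut: "upper_triangular T" and dT: "diag_mat T = es" by auto
  have c: "T \<in> carrier_mat d d" "P \<in> carrier_mat d d" "Q \<in> carrier_mat d d" "Q * P = 1\<^sub>m d"
    using similar_mat_witD2[OF A sim] by auto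
  define M where "M = 2 \<cdot>\<^sub>m char_matrix T (1 / 2)"
  have M: "M \<in> carrier_mat d d" "upper_triangular M"
    using c ut by (auto simp: M_def char_matrix_def upper_triangular_def)
  have Md: "M $$ (i, i) = 2 * T $$ (i, i) - 1" if "i < d" for i
    using c that by (simp add: M_def char_matrix_def)
  have simM: "similar_mat_wit (2 \<cdot>\<^sub>m char_matrix A (1 / 2)) M P Q"
    unfolding M_def by (intro similar_mat_wit_smult similar_mat_wit_char_matrix sim)
  have "mtrace ((2 \<cdot>\<^sub>m char_matrix A (1 / 2)) ^\<^sub>m k) = (\<Sum>i<d. (2 * T $$ (i, i) - 1) ^ k)" for k
  proof -
    have Mk: "M ^\<^sub>m k \<in> carrier_mat d d" using M by simp
    have "mtrace ((2 \<cdot>\<^sub>m char_matrix A (1 / 2)) ^\<^sub>m k) = mtrace ((P * M ^\<^sub>m k) * Q)"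
      by (simp add: similar_mat_wit_pow_id[OF simM])
    also have "\<dots> = mtrace (Q * (P * M ^\<^sub>m k))" using c Mk by (intro mtrace_mult_comm) auto
    also have "Q * (P * M ^\<^sub>m k) = M ^\<^sub>m k"
      using c left_mult_one_mat[OF Mk] Mk by (simp flip: assoc_mult_mat[of Q d d P d "M ^\<^sub>m k" d])
    also have "mtrace (M ^\<^sub>m k) = (\<Sum>i<d. (M $$ (i, i)) ^ k)"
      using Mk M upper_triangular_pow_entries[OF M] by (auto simp: mtrace_def intro!: sum.cong)
    finally show ?thesis by (simp add: Md)
  qed
  moreover have "eigenvalue A (T $$ (i, i))" if "i < d" for i
  proof -
    have "T $$ (i, i) \<in> set es" using that c(1) by (auto simp: dT[symmetric] diag_mat_def)
    then have "poly (char_poly A) (T $$ (i, i)) = 0" unfolding es poly_prod_list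
      by (force simp: prod_list_zero_iff)
    then show ?thesis using eigenvalue_root_char_poly[OF A] by simp
  qed
  ultimately show ?thesis by (intro exI[of _ "\<lambda>i. T $$ (i, i)"]) auto
qed

lemma fmat_pow:
  assumes "A \<in> carrier_mat d d" "herm d (fmat d A)"
  shows "fmat d (A ^\<^sub>m k) = mpow d (fmat d A) k"
proof (induction k)
  case 0 show ?case using assms by (auto simp: fmat_def mone_def fun_eq_iff)
next
  case (Suc k)
  have "fmat d (A ^\<^sub>m Suc k) = mmul d (mpow d (fmat d A) k) (mpow d (fmat d A) 1)"
    using assms Suc by (simp add: fmat_mult)
  then show ?case unfolding mpow_add[OF assms(2)] by simp
qed

text \<open>The map t to 2t - 1 sends [0, 1] to [-1, 1], so each of the 2^n summands of a moment is
  at most 1. Eigenvalues are used only here.\<close>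

lemma contraction_obs:
  assumes "measurement n E" shows "contraction (2 ^ n) (obs (2 ^ n) E)"
proof -
  let ?d = "2 ^ n :: nat"
  let ?M = "2 \<cdot>\<^sub>m char_matrix E (1 / 2)"
  have hE: "hermitian_mat ?d E" using assms by (simp add: measurement_def)
  then have E: "E \<in> carrier_mat ?d ?d" by (simp add: hermitian_mat_def)
  then have M: "?M \<in> carrier_mat ?d ?d" by (simp add: char_matrix_def)
  have eq: "fmat ?d ?M = obs ?d E" using E
    by (auto simp: fmat_def obs_def mone_def char_matrix_def fun_eq_iff)
  obtain t where t: "\<And>i. i < ?d \<Longrightarrow> eigenvalue E (t i)"
    and tr: "\<And>k. mtrace (?M ^\<^sub>m k) = (\<Sum>i<?d. (2 * t i - 1) ^ k)"
    using mtrace_pow_spectrum[OF E] by blast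
  have "mtr ?d (mpow ?d (obs ?d E) (2 ^ r)) \<le> real ?d" for r
  proof -
    have "mtr ?d (mpow ?d (obs ?d E) (2 ^ r)) = (\<Sum>i<?d. Re ((2 * t i - 1) ^ (2 ^ r)))"
      using M herm_obs[OF hE]
      by (simp add: fmat_pow[OF M, unfolded eq, symmetric] mtr_fmat tr)
    also have "\<dots> \<le> (\<Sum>i<?d. 1)"
    proof (intro sum_mono)
      fix i assume "i \<in> {..<?d}"
      then have ev: "Im (t i) = 0 \<and> 0 \<le> Re (t i) \<and> Re (t i) \<le> 1"
        using t assms by (simp add: measurement_def)
      then have "2 * t i - 1 = of_real (2 * Re (t i) - 1)" by (simp add: complex_eq_iff)
      then have "Re ((2 * t i - 1) ^ (2 ^ r)) = (2 * Re (t i) - 1) ^ (2 ^ r)"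
        by (metis Re_complex_of_real of_real_power)
      also have "\<dots> \<le> \<bar>2 * Re (t i) - 1\<bar> ^ (2 ^ r)" by (metis abs_ge_self power_abs)
      also have "\<dots> \<le> 1" using ev by (intro power_le_one) auto
      finally show "Re ((2 * t i - 1) ^ (2 ^ r)) \<le> 1" .
    qed
    finally show ?thesis by simp
  qed
  then show ?thesis using herm_obs[OF hE] by (simp add: contraction_def)
qed

section \<open>Ghost samples\<close>

text \<open>Positions below \<open>m\<close> hold the sample and the next \<open>m\<close> the ghost
  sample; \<open>S\<close> selects the pairs to be exchanged.\<close>

definition swap_pairs :: "nat \<Rightarrow> nat set \<Rightarrow> nat \<Rightarrow> nat" where
  "swap_pairs m S i = (if i < m then (if i \<in> S then m + i else i)
     else if i < 2 * m then (if i - m \<in> S then i - m else i) else i)"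

lemma swap_pairs_involution: "swap_pairs m S (swap_pairs m S i) = i"
  by (auto simp: swap_pairs_def)

lemma swap_pairs_permutes: "swap_pairs m S permutes {..<2 * m}"
proof (rule bij_imp_permutes)
  show "bij_betw (swap_pairs m S) {..<2 * m} {..<2 * m}"
    by (rule bij_betwI[where g = "swap_pairs m S"])
       (auto simp: swap_pairs_involution, auto simp: swap_pairs_def split: if_splits)
qed (simp add: swap_pairs_def)

text \<open>On every pair that contains a hit, \<open>S\<close> must move the hit into the ghost
  half and is thus forced. Only the other pairs are free, and at least \<open>t\<close> pairs
  contain a hit.\<close>

lemma card_swap_pairs_le:
  fixes G :: "nat \<Rightarrow> bool"
  shows "real (card {S \<in> Pow {..<m}. (\<forall>i<m. \<not> G (swap_pairs m S i)) \<and>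
      t \<le> real (card {i. i < m \<and> G (swap_pairs m S (m + i))})}) \<le> 2 ^ m * 2 powr (- t)"
    (is "real (card ?X) \<le> _")
proof (cases "?X = {}")
  case True
  show ?thesis unfolding True by simp
next
  case False
  define L where "L = {i. i < m \<and> (G i \<or> G (m + i))}"
  have fin: "finite L" by (simp add: L_def)
  have Lm: "L \<subseteq> {..<m}" by (auto simp: L_def)
  have det: "S \<inter> L = {i \<in> L. G i}" if "S \<in> ?X" for S
    using that by (force simp: L_def swap_pairs_def split: if_splits)
  \<comment> \<open>A member supplies the bound on \<open>t\<close>, since all its ghost hits belong
    to pairs in \<open>L\<close>.\<close>
  from False obtain S where S: "S \<in> ?X" by blast
  have "card {i. i < m \<and> G (swap_pairs m S (m + i))} \<le> card L"
    by (intro card_mono fin) (auto simp: L_def swap_pairs_def split: if_splits)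
  then have t: "t \<le> real (card L)" using S by auto
  have "card ?X \<le> card (Pow ({..<m} - L))"
  proof (rule card_inj_on_le[where f = "\<lambda>S. S - L"])
    show "inj_on (\<lambda>S. S - L) ?X"
    proof (rule inj_onI)
      fix S S' assume S: "S \<in> ?X" and S': "S' \<in> ?X" and "S - L = S' - L"
      moreover have "S \<inter> L = S' \<inter> L" unfolding det[OF S] det[OF S'] ..
      ultimately show "S = S'" by (metis Int_Diff_Un)
    qed
  qed auto
  also have "\<dots> = 2 ^ (m - card L)" using Lm fin by (simp add: card_Pow card_Diff_subset)
  finally have "real (card ?X) \<le> real (2 ^ (m - card L))" by (rule of_nat_mono)
  also have "real (2 ^ (m - card L)) = 2 ^ m * 2 powr (- real (card L))"
  proof -
    have "card L \<le> m" using card_mono[OF _ Lm] by simp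
    then have "(2::real) ^ (m - card L) = 2 ^ m / 2 ^ card L" by (simp add: power_diff)
    then show ?thesis by (simp add: powr_minus powr_realpow divide_inverse)
  qed
  also have "\<dots> \<le> 2 ^ m * 2 powr (- t)" using t by simp
  finally show ?thesis .
qed

text \<open>A Chernoff bound with weight 1/2 per hit: the expected product is at most exp(-t), and
  fewer than t hits make the product at least 2^(-t).\<close>

lemma measure_few_hits_le:
  fixes D :: "'a measure" and J :: "'i set"
  assumes "prob_space D" and X [measurable]: "X \<in> sets D" and J: "finite J"
    and p: "\<epsilon> \<le> measure D X" and big: "5 \<le> \<epsilon> * real (card J)"
  shows "measure (PiM J (\<lambda>_. D)) {y \<in> space (PiM J (\<lambda>_. D)). real (card {j \<in> J. y j \<in> X}) < \<epsilon> * real (card J) / 2} \<le> 1 / 2"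
proof -
  interpret D: prob_space D by fact
  interpret P: product_prob_space "\<lambda>_. D" J by standard
  let ?M = "PiM J (\<lambda>_. D)"
  define t where "t = \<epsilon> * real (card J) / 2"
  define h :: "'a \<Rightarrow> real" where "h e = (if e \<in> X then 1 / 2 else 1)" for e
  have hm [measurable]: "h \<in> borel_measurable D" unfolding h_def by measurable
  have hb: "0 \<le> h e" "h e \<le> 1" for e by (auto simp: h_def)
  have hi: "integrable D h" by (rule D.integrable_const_bound[where B = 1]) (use hb in auto)
  have "integral\<^sup>L D h = (\<integral>e. 1 - indicator X e / 2 \<partial>D)"
    by (intro Bochner_Integration.integral_cong) (auto simp: h_def)
  also have "\<dots> = 1 - measure D X / 2"
    by (subst Bochner_Integration.integral_diff)
       (auto simp: D.prob_space D.emeasure_eq_measure intro!: integrable_divide integrable_real_indicator)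
  also have "\<dots> \<le> 1 - \<epsilon> / 2" using p by simp
  also have "\<dots> \<le> exp (- \<epsilon> / 2)" using exp_ge_add_one_self[of "- \<epsilon> / 2"] by simp
  finally have "integral\<^sup>L D h ^ card J \<le> exp (- \<epsilon> / 2) ^ card J"
    using hb by (intro power_mono) auto
  also have "\<dots> = exp (- t)" by (simp add: t_def flip: exp_of_nat_mult)
  finally have prod: "(\<integral>y. (\<Prod>j\<in>J. h (y j)) \<partial>?M) \<le> exp (- t)"
    using P.product_integral_prod[OF J, of "\<lambda>_. h"] hi by simp
  have hprod: "(\<Prod>j\<in>J. h (y j)) = 2 powr (- real (card {j \<in> J. y j \<in> X}))" for y
  proof -
    have "(\<Prod>j\<in>J. h (y j)) = (\<Prod>j\<in>{j \<in> J. y j \<in> X}. 1 / 2)"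
      unfolding h_def using J by (subst prod.inter_filter[symmetric]) auto
    then show ?thesis by (simp add: powr_minus powr_realpow power_divide inverse_eq_divide)
  qed
  have int: "integrable ?M (\<lambda>y. \<Prod>j\<in>J. h (y j))"
    using P.product_integrable_prod[OF J, of "\<lambda>_. h"] hi by simp
  have "measure ?M {y \<in> space ?M. real (card {j \<in> J. y j \<in> X}) < t}
     \<le> measure ?M {y \<in> space ?M. 2 powr (- t) \<le> (\<Prod>j\<in>J. h (y j))}"
  proof (rule P.P.finite_measure_mono)
    show "{y \<in> space ?M. 2 powr (- t) \<le> (\<Prod>j\<in>J. h (y j))} \<in> sets ?M"
      by (rule borel_measurable_iff_ge[THEN iffD1, rule_format, OF borel_measurable_integrable[OF int]])
  qed (auto simp: hprod)
  also have "\<dots> \<le> (\<integral>y. (\<Prod>j\<in>J. h (y j)) \<partial>?M) / 2 powr (- t)"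
    by (rule integral_Markov_inequality_measure[OF int sets.top]) (auto simp: hb prod_nonneg)
  also have "\<dots> \<le> exp (- t) / 2 powr (- t)" using prod by (intro divide_right_mono) auto
  also have "\<dots> = exp (- (t * (1 - ln 2)))" by (simp add: powr_def exp_diff[symmetric] algebra_simps)
  also have "\<dots> \<le> exp (- ln 2)"
  proof -
    \<comment> \<open>As t \<ge> 5/2 and ln 2 \<le> 25/36, the exponent is at least 55/72, which
      exceeds 50/72 \<ge> ln 2.\<close>
    have "5 / 2 * (11 / 36) \<le> t * (1 - ln 2)"
      using big ln2_le_25_over_36 by (intro mult_mono) (auto simp: t_def)
    then show ?thesis using ln2_le_25_over_36 by simp
  qed
  finally show ?thesis by (simp add: t_def exp_minus)
qed

text \<open>Symmetrisation with a data-dependent cover: \<open>V z c\<close> is the cover member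
  named \<open>c\<close> on the double sample \<open>z\<close>, and \<open>sym\<close> says that
  permuting the sample only renames members. The good samples are cut out by possibly uncountably
  many conditions, so a measurable subset of them is produced.\<close>

lemma ghost_sample_bound:
  fixes D :: "'a measure" and F :: "('a \<Rightarrow> real) set" and V :: "(nat \<Rightarrow> 'a) \<Rightarrow> 'c \<Rightarrow> nat \<Rightarrow> real"
  assumes D: "prob_space D" and F [measurable]: "\<And>f. f \<in> F \<Longrightarrow> f \<in> borel_measurable D"
    and Cs: "finite Cs"
    and V: "\<And>c i. c \<in> Cs \<Longrightarrow> i < 2 * m \<Longrightarrow> (\<lambda>z. V z c i) \<in> borel_measurable (PiM {..<2 * m} (\<lambda>_. D))"
    and cover: "\<And>z f. z \<in> space (PiM {..<2 * m} (\<lambda>_. D)) \<Longrightarrow> f \<in> F \<Longrightarrow>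
        \<exists>c\<in>Cs. \<forall>i<2 * m. \<bar>V z c i - f (z i)\<bar> \<le> \<beta>"
    and sym: "\<And>z c \<pi>. z \<in> space (PiM {..<2 * m} (\<lambda>_. D)) \<Longrightarrow> c \<in> Cs \<Longrightarrow> \<pi> permutes {..<2 * m} \<Longrightarrow>
        \<exists>c'\<in>Cs. \<forall>i<2 * m. V (\<lambda>j\<in>{..<2 * m}. z (\<pi> j)) c i = V z c' (\<pi> i)"
    and big: "5 \<le> \<epsilon> * real m" and ab: "a + 2 * \<beta> \<le> b"
  shows "\<exists>A\<in>sets (PiM {..<m} (\<lambda>_. D)).
    A \<subseteq> {x. \<forall>f\<in>F. (\<forall>i<m. \<bar>f (x i)\<bar> \<le> a) \<longrightarrow> measure D {E \<in> space D. \<bar>f E\<bar> > b} \<le> \<epsilon>} \<and>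
    measure (PiM {..<m} (\<lambda>_. D)) A \<ge> 1 - 2 * real (card Cs) * 2 powr (- (\<epsilon> * real m / 2))"
proof -
  interpret D: prob_space D by fact
  interpret P: product_prob_space "\<lambda>_. D" UNIV by standard
  define I where "I = {..<m}"
  define J where "J = {m..<2 * m}"
  define K where "K = {..<2 * m}"
  define t where "t = \<epsilon> * real m / 2"
  let ?I = "PiM I (\<lambda>_. D)" and ?J = "PiM J (\<lambda>_. D)" and ?K = "PiM K (\<lambda>_. D)"
  have IJ: "I \<union> J = K" "I \<inter> J = {}" "finite I" "finite J" "finite K"
    by (auto simp: I_def J_def K_def)
  interpret PI: prob_space ?I by (intro prob_space_PiM D)
  interpret PJ: prob_space ?J by (intro prob_space_PiM D)
  interpret PK: prob_space ?K by (intro prob_space_PiM D)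
  \<comment> \<open>The threshold lies between the two regimes: values of f up to \<open>a\<close>
    stay at or below it after an error \<beta>, and values beyond \<open>b\<close> stay above
    it.\<close>
  define g where "g z c i \<longleftrightarrow> \<bar>V z c i\<bar> > a + \<beta>" for z c i
  have gm: "Measurable.pred ?K (\<lambda>z. g z c i)" if "c \<in> Cs" "i < 2 * m" for c i
  proof -
    note V[OF that, folded K_def, measurable]
    show ?thesis unfolding g_def by measurable
  qed
  have card_sum: "real (card {i. i < m \<and> Q i}) = (\<Sum>i<m. if Q i then 1 else 0)" for Q
  proof -
    have "{i. i < m \<and> Q i} = {..<m} \<inter> {i. Q i}" by auto
    then show ?thesis by (simp add: sum.If_cases)
  qed
  define Wc where "Wc c = {z \<in> space ?K. (\<forall>i<m. \<not> g z c i) \<and> t \<le> real (card {i. i < m \<and> g z c (m + i)})}" for c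
  define W where "W = (\<Union>c\<in>Cs. Wc c)"
  have Wc: "Wc c \<in> sets ?K" if "c \<in> Cs" for c
  proof -
    have [measurable]: "Measurable.pred ?K (\<lambda>z. g z c i)" if "i \<in> {..<2 * m}" for i using gm \<open>c \<in> Cs\<close> that by simp
    have "Wc c = {z \<in> space ?K. (\<forall>i\<in>{..<m}. \<not> g z c i) \<and> t \<le> (\<Sum>i<m. if g z c (m + i) then 1 else 0)}"
      unfolding Wc_def card_sum by auto
    also have "\<dots> \<in> sets ?K" by measurable
    finally show ?thesis .
  qed
  then have W: "W \<in> sets ?K" using Cs by (auto simp: W_def)
  define sw where "sw S z = (\<lambda>j\<in>K. z (swap_pairs m S j))" for S and z :: "nat \<Rightarrow> 'a"
  have swK: "swap_pairs m S j \<in> K \<longleftrightarrow> j \<in> K" for S j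
    using permutes_in_image[OF swap_pairs_permutes] by (auto simp: K_def)
  have sw_meas: "sw S \<in> measurable ?K ?K" for S
    unfolding sw_def by (intro measurable_restrict measurable_component_singleton) (simp add: swK)
  \<comment> \<open>The coordinates are independent with the same distribution, so a swap preserves
    the product measure.\<close>
  have sw_W: "emeasure ?K (sw S -` W \<inter> space ?K) = emeasure ?K W" for S
  proof -
    have "distr ?K ?K (sw S) = ?K"
      unfolding sw_def
      using distr_PiM_reindex[of K "\<lambda>_. D" "swap_pairs m S" K] D swK permutes_inj_on[OF swap_pairs_permutes]
      by auto
    then show ?thesis using emeasure_distr[OF sw_meas W, of S] by simp
  qed
  \<comment> \<open>For a fixed double sample, equivariance keeps the cover fixed while the
    positions are swapped, so a union bound over its members applies.\<close>
  have count: "(\<Sum>S\<in>Pow I. indicator (sw S -` W \<inter> space ?K) z) \<le> ennreal (real (card Cs) * (2 ^ m * 2 powr (- t)))"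
    if z: "z \<in> space ?K" for z
  proof -
    define X where "X c = {S \<in> Pow {..<m}. (\<forall>i<m. \<not> g z c (swap_pairs m S i)) \<and>
      t \<le> real (card {i. i < m \<and> g z c (swap_pairs m S (m + i))})}" for c
    have sub: "{S \<in> Pow I. sw S z \<in> W} \<subseteq> (\<Union>c\<in>Cs. X c)"
    proof
      fix S assume "S \<in> {S \<in> Pow I. sw S z \<in> W}"
      then obtain c where S: "S \<in> Pow {..<m}" and c: "c \<in> Cs" "sw S z \<in> Wc c" by (auto simp: W_def I_def)
      obtain c' where c': "c' \<in> Cs" "\<And>i. i < 2 * m \<Longrightarrow> V (sw S z) c i = V z c' (swap_pairs m S i)"
        using sym[OF z[unfolded K_def] c(1) swap_pairs_permutes] unfolding sw_def K_def by blast
      then have "g (sw S z) c i = g z c' (swap_pairs m S i)" if "i < 2 * m" for i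
        using that by (simp add: g_def)
      then have "S \<in> X c'" using S c(2) by (simp add: X_def Wc_def cong: conj_cong)
      then show "S \<in> (\<Union>c\<in>Cs. X c)" using c'(1) by blast
    qed
    have "(\<Sum>S\<in>Pow I. indicator (sw S -` W \<inter> space ?K) z) = (of_nat (card {S \<in> Pow I. sw S z \<in> W}) :: ennreal)"
    proof -
      have "(\<Sum>S\<in>Pow I. indicator (sw S -` W \<inter> space ?K) z) = (\<Sum>S\<in>Pow I. if sw S z \<in> W then 1 else (0::ennreal))"
        using z by (intro sum.cong refl) (auto simp: indicator_def)
      also have "\<dots> = of_nat (card {S \<in> Pow I. sw S z \<in> W})"
        using IJ by (simp add: sum.If_cases Int_def)
      finally show ?thesis .
    qed
    also have "\<dots> = ennreal (real (card {S \<in> Pow I. sw S z \<in> W}))" by (simp add: ennreal_of_nat_eq_real_of_nat)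
    also have "\<dots> \<le> ennreal (real (card Cs) * (2 ^ m * 2 powr (- t)))"
    proof (rule ennreal_leI)
      have "card {S \<in> Pow I. sw S z \<in> W} \<le> card (\<Union>c\<in>Cs. X c)"
        using sub Cs by (intro card_mono) (auto simp: X_def)
      also have "\<dots> \<le> (\<Sum>c\<in>Cs. card (X c))" by (rule card_UN_le[OF Cs])
      finally have "real (card {S \<in> Pow I. sw S z \<in> W}) \<le> (\<Sum>c\<in>Cs. real (card (X c)))"
        by (metis of_nat_le_iff of_nat_sum)
      also have "\<dots> \<le> (\<Sum>c\<in>Cs. 2 ^ m * 2 powr (- t))"
        unfolding X_def by (intro sum_mono card_swap_pairs_le)
      finally show "real (card {S \<in> Pow I. sw S z \<in> W}) \<le> real (card Cs) * (2 ^ m * 2 powr (- t))" by simp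
    qed
    finally show ?thesis .
  qed
  have Wle: "measure ?K W \<le> real (card Cs) * 2 powr (- t)"
  proof -
    \<comment> \<open>Averaging over all 2^m swaps: the left side is 2^m times the measure of
      \<open>W\<close>, the right side integrates the pointwise count.\<close>
    have "(\<Sum>S\<in>Pow I. emeasure ?K (sw S -` W \<inter> space ?K))
        = (\<integral>\<^sup>+ z. (\<Sum>S\<in>Pow I. indicator (sw S -` W \<inter> space ?K) z) \<partial>?K)"
      using measurable_sets[OF sw_meas W] by (subst nn_integral_sum) (auto simp: nn_integral_indicator)
    also have "\<dots> \<le> (\<integral>\<^sup>+ z. ennreal (real (card Cs) * (2 ^ m * 2 powr (- t))) \<partial>?K)"
      by (intro nn_integral_mono count)
    also have "\<dots> = ennreal (real (card Cs) * (2 ^ m * 2 powr (- t)))"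
      by (simp add: PK.emeasure_space_1)
    also have "(\<Sum>S\<in>Pow I. emeasure ?K (sw S -` W \<inter> space ?K)) = ennreal (2 ^ m * measure ?K W)"
      unfolding sw_W using IJ
      by (simp add: card_Pow I_def PK.emeasure_eq_measure ennreal_mult ennreal_power flip: ennreal_numeral)
    finally have "2 ^ m * measure ?K W \<le> 2 ^ m * (real (card Cs) * 2 powr (- t))"
      by (simp add: ennreal_le_iff ac_simps)
    then show ?thesis by simp
  qed
  define Q where "Q = merge I J -` W \<inter> space (?I \<Otimes>\<^sub>M ?J)"
  have mm: "merge I J \<in> measurable (?I \<Otimes>\<^sub>M ?J) ?K" using measurable_merge[of I J "\<lambda>_. D"] IJ by simp
  have Q: "Q \<in> sets (?I \<Otimes>\<^sub>M ?J)" unfolding Q_def by (rule measurable_sets[OF mm W])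
  have EQ: "emeasure (?I \<Otimes>\<^sub>M ?J) Q = emeasure ?K W"
    using emeasure_distr[OF mm W] P.distr_merge[OF IJ(2-4)] by (simp add: Q_def IJ)
  define e where "e x = emeasure ?J (Pair x -` Q)" for x
  have em [measurable]: "e \<in> borel_measurable ?I" unfolding e_def by (rule PJ.measurable_emeasure_Pair[OF Q])
  \<comment> \<open>Samples for which the ghost sample completes them to a member of
    \<open>W\<close> with probability at least 1/2; by Markov their measure is at most twice that of
    \<open>W\<close>.\<close>
  define B where "B = {x \<in> space ?I. 1 \<le> 2 * e x}"
  have B: "B \<in> sets ?I" unfolding B_def by measurable
  have "emeasure ?I B \<le> 2 * (\<integral>\<^sup>+ x. e x * indicator (space ?I) x \<partial>?I)"
    unfolding B_def by (rule nn_integral_Markov_inequality) auto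
  also have "(\<integral>\<^sup>+ x. e x * indicator (space ?I) x \<partial>?I) = (\<integral>\<^sup>+ x. e x \<partial>?I)"
    by (intro nn_integral_cong) auto
  also have "\<dots> = emeasure ?K W" unfolding e_def EQ[symmetric] by (rule PJ.emeasure_pair_measure_alt[OF Q, symmetric])
  finally have "ennreal (measure ?I B) \<le> ennreal (2 * measure ?K W)"
    by (simp add: PI.emeasure_eq_measure PK.emeasure_eq_measure ennreal_mult)
  then have Ble: "measure ?I B \<le> 2 * real (card Cs) * 2 powr (- t)"
    using Wle by (simp add: ennreal_le_iff)
  define A where "A = space ?I - B"
  have A: "A \<in> sets ?I" using B by (auto simp: A_def)
  have "measure ?I A = 1 - measure ?I B" unfolding A_def by (rule PI.prob_compl[OF B])
  then have Am: "measure ?I A \<ge> 1 - 2 * real (card Cs) * 2 powr (- t)" using Ble by simp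
  have Ag: "measure D {E \<in> space D. \<bar>f E\<bar> > b} \<le> \<epsilon>"
    if x: "x \<in> A" and f: "f \<in> F" and small: "\<forall>i<m. \<bar>f (x i)\<bar> \<le> a" for x f
  proof (rule ccontr)
    let ?X = "{E \<in> space D. \<bar>f E\<bar> > b}"
    assume "\<not> ?thesis"
    then have p: "\<epsilon> \<le> measure D ?X" by simp
    have [measurable]: "f \<in> borel_measurable D" using f F by simp
    have X: "?X \<in> sets D" by measurable
    have xs: "x \<in> space ?I" using x by (simp add: A_def)
    define N where "N = {y \<in> space ?J. real (card {j \<in> J. y j \<in> ?X}) < t}"
    have cJ: "card J = m" by (simp add: J_def)
    have "measure ?J N \<le> 1 / 2"
      unfolding N_def t_def using measure_few_hits_le[OF D X IJ(4) p] big cJ by simp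
    have Nm: "N \<in> sets ?J"
    proof -
      have "real (card {j \<in> J. y j \<in> ?X}) = (\<Sum>j\<in>J. indicator ?X (y j))" for y
        using IJ by (simp add: indicator_def sum.If_cases Int_def)
      then have "N = {y \<in> space ?J. (\<Sum>j\<in>J. indicator ?X (y j)) < t}" by (simp add: N_def)
      also have "\<dots> \<in> sets ?J" using X by measurable
      finally show ?thesis .
    qed
    \<comment> \<open>Every ghost sample with enough hits completes a violating sample to a member
      of \<open>W\<close>, witnessed by a cover member close to \<open>f\<close>. Such ghost samples
      have probability at least 1/2.\<close>
    have "space ?J - N \<subseteq> Pair x -` Q"
    proof
      fix y assume y: "y \<in> space ?J - N"
      let ?z = "merge I J (x, y)"
      have z: "?z \<in> space ?K" using measurable_space[OF mm, of "(x, y)"] xs y by (simp add: space_pair_measure)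
      obtain c where c: "c \<in> Cs" "\<And>i. i < 2 * m \<Longrightarrow> \<bar>V ?z c i - f (?z i)\<bar> \<le> \<beta>"
        using cover[OF z[unfolded K_def] f] by blast
      have zi: "?z i = x i" if "i < m" for i using that by (simp add: merge_def I_def)
      have zj: "?z j = y j" if "j \<in> J" for j using that by (auto simp: merge_def I_def J_def)
      have "\<not> g ?z c i" if "i < m" for i
        using c(2)[of i] zi[OF that] small that unfolding g_def by force
      moreover have "t \<le> real (card {i. i < m \<and> g ?z c (m + i)})"
      proof -
        have "\<not> real (card {j \<in> J. y j \<in> ?X}) < t" using y unfolding N_def by blast
        then have "t \<le> real (card {j \<in> J. y j \<in> ?X})" by simp
        also have "real (card {j \<in> J. y j \<in> ?X}) \<le> real (card ((\<lambda>i. m + i) ` {i. i < m \<and> g ?z c (m + i)}))"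
        proof (intro of_nat_mono card_mono subsetI)
          fix j assume j: "j \<in> {j \<in> J. y j \<in> ?X}"
          then have "g ?z c j" using c(2)[of j] zj[of j] ab unfolding g_def J_def by force
          then show "j \<in> (\<lambda>i. m + i) ` {i. i < m \<and> g ?z c (m + i)}"
            using j by (intro image_eqI[of _ _ "j - m"]) (auto simp: J_def)
        qed auto
        also have "\<dots> = real (card {i. i < m \<and> g ?z c (m + i)})" by (simp add: card_image)
        finally show ?thesis by simp
      qed
      ultimately have "?z \<in> W" using z c(1) by (auto simp: W_def Wc_def)
      then show "y \<in> Pair x -` Q" using xs y by (simp add: Q_def space_pair_measure)
    qed
    then have "emeasure ?J (space ?J - N) \<le> e x"
      unfolding e_def by (rule emeasure_mono[OF _ sets_Pair1[OF Q]])
    moreover have "ennreal (1 / 2) \<le> emeasure ?J (space ?J - N)"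
      using PJ.prob_compl[OF Nm] \<open>measure ?J N \<le> 1 / 2\<close> unfolding PJ.emeasure_eq_measure by (intro ennreal_leI) linarith
    ultimately have "ennreal (1 / 2) \<le> e x" by (rule order_trans[rotated])
    then have "2 * ennreal (1 / 2) \<le> 2 * e x" by (rule mult_left_mono) simp
    moreover have "2 * ennreal (1 / 2) = 1"
      by (subst ennreal_numeral[symmetric], subst ennreal_mult[symmetric]) auto
    ultimately have "x \<in> B" using xs by (simp add: B_def)
    then show False using x by (simp add: A_def)
  qed
  show ?thesis using A Am Ag unfolding I_def t_def by (intro bexI[of _ A]) auto
qed

section \<open>Sample size\<close>

lemma ln_le_over_500:
  fixes z :: real assumes "z \<ge> 1000000" shows "ln z \<le> z / 500"
proof -
  have s: "sqrt z \<ge> 1000" using assms by (intro real_le_rsqrt) auto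
  have z: "z > 0" using assms by linarith
  have "ln (sqrt z) \<le> sqrt z" using s ln_le_minus_one[of "sqrt z"] by linarith
  then have ln1: "ln z \<le> 2 * sqrt z" using z by (simp add: ln_sqrt)
  have "sqrt z * 1000 \<le> sqrt z * sqrt z" using s z by (intro mult_left_mono) auto
  moreover have "sqrt z * sqrt z = z" using z by simp
  ultimately have "2 * sqrt z \<le> z / 500" by linarith
  with ln1 show ?thesis by linarith
qed

text \<open>With x = \<epsilon>m and y = n / \<alpha>^2, the logarithm of the cover size is at most
  x / 10, while the swap bound contributes -(x / 2) ln 2; the difference absorbs ln 2 and ln (1 /
  \<delta>).\<close>

lemma sample_size_arith:
  fixes \<alpha> \<epsilon> \<delta> L :: real and n m T :: nat
  assumes n: "n \<ge> 1" and \<alpha>: "0 < \<alpha>" "\<alpha> < 1" and \<epsilon>: "0 < \<epsilon>" "\<epsilon> < 1" and \<delta>: "0 < \<delta>" "\<delta> < 1"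
    and L: "L = ln (real n / (\<alpha> * \<epsilon>))" "1 / 10 \<le> L"
    and m: "100000000 / \<epsilon> * (real n / \<alpha>\<^sup>2 * L\<^sup>2 + ln (1 / \<delta>)) \<le> real m"
    and T: "real T \<le> 9 * (real n / \<alpha>\<^sup>2)"
  shows "5 \<le> \<epsilon> * real m" "2 * (4 * real m + 1) ^ T * 2 powr (- (\<epsilon> * real m / 2)) \<le> \<delta>"
proof -
  define x where "x = \<epsilon> * real m"
  define y where "y = real n / \<alpha>\<^sup>2"
  define l where "l = ln (1 / \<delta>)"
  have l: "l > 0" using \<delta> by (simp add: l_def)
  have "\<alpha>\<^sup>2 \<le> 1" using \<alpha> by (intro power_le_one) auto
  then have y: "y \<ge> 1" using n \<alpha> by (simp add: y_def field_simps)
  have xK: "100000000 * (y * L\<^sup>2 + l) \<le> x"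
    using m \<epsilon> by (simp add: x_def y_def l_def field_simps)
  \<comment> \<open>Because \<open>L\<close> is bounded away from 0, constant and linear terms in it
    are absorbed by L^2.\<close>
  have L2: "1 / 100 \<le> L\<^sup>2" "L \<le> 10 * L\<^sup>2"
    using power_mono[OF L(2), of 2] mult_right_mono[OF L(2), of L] L(2) by (auto simp: power2_eq_square)
  have "0 \<le> y * L\<^sup>2" using y by (intro mult_nonneg_nonneg) auto
  then have yL: "100000000 * (y * L\<^sup>2) \<le> x" and yl: "100000000 * l \<le> x"
    using xK l by auto
  have yL1: "y / 100 \<le> y * L\<^sup>2" using mult_left_mono[OF L2(1), of y] y by simp
  have xy: "1000000 * y \<le> x" using yL yL1 by linarith
  then have x6: "1000000 \<le> x" using y by linarith
  then show "5 \<le> \<epsilon> * real m" by (simp add: x_def)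
  have m0: "real m \<ge> 1" using x6 \<epsilon> unfolding x_def by (cases m) auto
  have lns: "0 \<le> ln (real n)" "0 \<le> - ln \<alpha>" "0 \<le> - ln \<epsilon>" using n \<alpha> \<epsilon> by auto
  have Ls: "L = ln (real n) - ln \<alpha> - ln \<epsilon>" using n \<alpha> \<epsilon> by (simp add: L(1) ln_div ln_mult)
  have lny: "ln y = ln (real n) - 2 * ln \<alpha>" using n \<alpha> by (simp add: y_def ln_div ln_realpow)
  \<comment> \<open>The part ln y - ln \<epsilon> is at most 2L. The rest, ln (x / y), is not
    controlled by \<open>L\<close> but is a small fraction of x / y, which becomes a small fraction
    of x after multiplication by 9y.\<close>
  have lnm: "ln (real m) = ln (x / y) + ln y - ln \<epsilon>"
    using m0 \<epsilon> y by (simp add: x_def ln_div ln_mult)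
  have z: "ln (x / y) \<le> x / y / 500" by (rule ln_le_over_500) (use xy y in \<open>simp add: field_simps\<close>)
  have ln5: "ln 5 \<le> (4::real)" using ln_le_minus_one[of "5::real"] by simp
  have "ln (4 * real m + 1) \<le> ln (5 * real m)" using m0 by simp
  also have "\<dots> = ln 5 + ln (real m)" using m0 by (simp add: ln_mult)
  also have "\<dots> \<le> 4 + x / y / 500 + 3 * L" using ln5 z lnm lny Ls lns by linarith
  finally have lnb: "ln (4 * real m + 1) \<le> 4 + x / y / 500 + 3 * L" .
  have "real T * ln (4 * real m + 1) \<le> (9 * y) * (4 + x / y / 500 + 3 * L)"
    using T lnb by (intro mult_mono) (auto simp: y_def)
  also have "\<dots> = 36 * y + 9 * x / 500 + 27 * (y * L)" using y by (simp add: field_simps)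
  also have "y * L \<le> 10 * (y * L\<^sup>2)" using mult_left_mono[OF L2(2), of y] y by simp
  finally have Tb: "real T * ln (4 * real m + 1) \<le> x / 10"
    using xy yL x6 by linarith
  have ln2: "1 / 2 \<le> ln (2::real)" "ln (2::real) \<le> 1" using ln2_ge_two_thirds ln_2_less_1 by linarith+
  have "x / 2 * (1 / 2) \<le> x / 2 * ln 2" using ln2 x6 by (intro mult_left_mono) auto
  then have *: "ln 2 + real T * ln (4 * real m + 1) - x / 2 * ln 2 \<le> - l"
    using Tb ln2 yl x6 by linarith
  have "2 * (4 * real m + 1) ^ T * 2 powr (- (\<epsilon> * real m / 2))
     = exp (ln 2 + real T * ln (4 * real m + 1) - x / 2 * ln 2)"
  proof -
    have "(4 * real m + 1) ^ T = exp (real T * ln (4 * real m + 1))" by (simp add: exp_of_nat_mult)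
    moreover have "2 powr (- (\<epsilon> * real m / 2)) = exp (- (x / 2 * ln 2))" by (simp add: powr_def x_def)
    moreover have "exp (ln 2 + u - v) = 2 * exp u * exp (- v)" for u v :: real
      by (simp add: exp_add exp_diff exp_minus divide_inverse)
    ultimately show ?thesis by simp
  qed
  also have "\<dots> \<le> exp (- l)" using * by simp
  also have "\<dots> = \<delta>" using \<delta> by (simp add: l_def ln_div)
  finally show "2 * (4 * real m + 1) ^ T * 2 powr (- (\<epsilon> * real m / 2)) \<le> \<delta>" .
qed

lemma power_of_two_between:
  assumes "n \<ge> 1" shows "\<exists>r\<ge>1. n \<le> 2 ^ r \<and> 2 ^ r \<le> 2 * (n::nat)"
  using assms
proof (induction n rule: nat_induct_at_least)
  case base show ?case by (intro exI[of _ 1]) simp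
next
  case (Suc n)
  then obtain r where r: "r \<ge> 1" "n \<le> 2 ^ r" "2 ^ r \<le> 2 * n" by blast
  show ?case
  proof (cases "Suc n \<le> 2 ^ r")
    case True
    then show ?thesis using r by (intro exI[of _ r]) auto
  next
    case False
    then have "n = 2 ^ r" using r by simp
    then show ?thesis using r by (intro exI[of _ "Suc r"]) auto
  qed
qed

lemma card_short_lists_le:
  assumes "finite A" shows "card {xs. set xs \<subseteq> A \<and> length xs \<le> n} \<le> (card A + 1) ^ n"
proof -
  have "(\<Sum>i\<le>n. card A ^ i) \<le> (card A + 1) ^ n"
  proof (induction n)
    case (Suc n)
    have "(\<Sum>i\<le>Suc n. card A ^ i) = (\<Sum>i\<le>n. card A ^ i) + card A * card A ^ n" by simp
    also have "\<dots> \<le> (card A + 1) ^ n + card A * (card A + 1) ^ n"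
      by (intro add_mono Suc mult_left_mono power_mono) auto
    finally show ?case by simp
  qed simp
  then show ?thesis by (simp add: card_lists_length_le[OF assms])
qed

section \<open>Learning states\<close>

lemma borel_measurable_mmul:
  assumes "\<And>i j. (\<lambda>z. A z i j) \<in> borel_measurable M" "\<And>i j. (\<lambda>z. B z i j) \<in> borel_measurable M"
  shows "(\<lambda>z. mmul d (A z) (B z) i j) \<in> borel_measurable M"
  unfolding mmul_def by (intro borel_measurable_sum borel_measurable_times assms)

lemma borel_measurable_mpow:
  assumes "\<And>i j. (\<lambda>z. A z i j) \<in> borel_measurable M"
  shows "(\<lambda>z. mpow d (A z) k i j) \<in> borel_measurable M"
  by (induction k arbitrary: i j) (auto intro!: borel_measurable_mmul assms)

lemma borel_measurable_mtr:
  assumes "\<And>i j. (\<lambda>z. A z i j) \<in> borel_measurable M"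
  shows "(\<lambda>z. mtr d (A z)) \<in> borel_measurable M"
proof -
  note assms [measurable]
  show ?thesis unfolding mtr_def by measurable
qed

lemma borel_measurable_gradient:
  assumes A: "\<And>i j. (\<lambda>z. A z i j) \<in> borel_measurable M" and B: "\<And>i j. (\<lambda>z. B z i j) \<in> borel_measurable M"
  shows "(\<lambda>z. gradient d q (A z) (B z)) \<in> borel_measurable M"
proof -
  note borel_measurable_mtr[OF borel_measurable_mpow[OF A], measurable]
    borel_measurable_mtr[OF borel_measurable_mmul[OF borel_measurable_mpow[OF A] B], measurable]
  show ?thesis unfolding gradient_def pot_def by measurable
qed

lemma borel_measurable_signed_sum:
  assumes "\<And>l i j. l \<in> fst ` set xs \<Longrightarrow> (\<lambda>z. H z l i j) \<in> borel_measurable M"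
  shows "(\<lambda>z. signed_sum (H z) xs i j) \<in> borel_measurable M"
  using assms by (induction xs) (auto simp: mlin_def intro!: borel_measurable_add borel_measurable_times)

text \<open>The source of equivariance: permuting the sample amounts to renaming the indices in the
  list.\<close>

lemma signed_sum_map:
  assumes "\<And>l. l \<in> fst ` set xs \<Longrightarrow> H' l = H (\<pi> l)"
  shows "signed_sum H' xs = signed_sum H (map (map_prod \<pi> id) xs)"
  using assms by (induction xs) auto

lemma borel_measurable_obs:
  assumes "\<And>i j. i < d \<Longrightarrow> j < d \<Longrightarrow> (\<lambda>E. E $$ (i, j)) \<in> borel_measurable D"
  shows "(\<lambda>E. obs d E i j) \<in> borel_measurable D"
  using assms[of i j] by (cases "i < d \<and> j < d") (auto simp: obs_def fmat_def)

text \<open>For an effect and a state this is twice the acceptance probability minus one.\<close>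

definition score :: "nat \<Rightarrow> complex mat \<Rightarrow> complex mat \<Rightarrow> real" where
  "score n \<sigma> E = mtr (2 ^ n) (mmul (2 ^ n) (obs (2 ^ n) E) (fmat (2 ^ n) \<sigma>))"

lemma score_acc:
  assumes "measurement n E" "qstate n \<sigma>" "qstate n \<rho>"
  shows "\<bar>score n \<sigma> E - score n \<rho> E\<bar> = 2 * cmod (acc E \<sigma> - acc E \<rho>)"
  using cmod_acc_diff[of n E \<sigma> \<rho>] assms by (simp add: score_def measurement_def)

lemma score_abs_le:
  assumes "measurement n E" "qstate n \<sigma>" shows "\<bar>score n \<sigma> E\<bar> \<le> 1"
  unfolding score_def by (intro state_contraction_abs_le qstate_posf contraction_obs assms)

lemma good_iff_score:
  assumes \<rho>: "qstate n \<rho>" and sp: "space D \<subseteq> {E. measurement n E}" and Es: "\<And>i. i < m \<Longrightarrow> Es i \<in> space D"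
  shows "good n \<rho> D \<epsilon> \<eta> \<gamma> m Es \<longleftrightarrow>
    (\<forall>\<sigma>. qstate n \<sigma> \<longrightarrow> (\<forall>i<m. \<bar>score n \<sigma> (Es i) - score n \<rho> (Es i)\<bar> \<le> 2 * \<eta>) \<longrightarrow>
      measure D {E \<in> space D. \<bar>score n \<sigma> E - score n \<rho> E\<bar> > 2 * \<gamma>} \<le> \<epsilon>)"
proof -
  have "{E \<in> space D. \<bar>score n \<sigma> E - score n \<rho> E\<bar> > 2 * \<gamma>} = {E \<in> space D. cmod (acc E \<sigma> - acc E \<rho>) > \<gamma>}"
    if "qstate n \<sigma>" for \<sigma>
    using sp score_acc[OF _ that \<rho>] by auto
  moreover have "\<bar>score n \<sigma> (Es i) - score n \<rho> (Es i)\<bar> \<le> 2 * \<eta> \<longleftrightarrow> cmod (acc (Es i) \<sigma> - acc (Es i) \<rho>) \<le> \<eta>"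
    if "qstate n \<sigma>" "i < m" for \<sigma> i
    using sp Es[OF that(2)] score_acc[OF _ that(1) \<rho>, of "Es i"] by auto
  ultimately show ?thesis unfolding good_def by (simp cong: imp_cong)
qed

lemma two_powr_dim_le: "n \<le> q \<Longrightarrow> 0 < q \<Longrightarrow> real (2 ^ n) powr (2 / real q) \<le> 4"
proof -
  assume "n \<le> q" "0 < q"
  have "real (2 ^ n) powr (2 / real q) = 2 powr (real n * (2 / real q))"
    by (simp add: powr_powr flip: powr_realpow)
  also have "\<dots> \<le> 2 powr 2" using \<open>n \<le> q\<close> \<open>0 < q\<close> by (intro powr_mono) (auto simp: field_simps)
  finally show ?thesis by simp
qed

text \<open>The case where the logarithm is at least 1/10. A power of two \<open>q\<close> between n
  and 2n keeps d^(2/q) at most 4 and the list length at most 9n / (\<gamma> - \<eta>)^2.\<close>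

lemma good_with_high_probability:
  fixes D :: "complex mat measure"
  assumes n: "n \<ge> 1" and \<rho>: "qstate n \<rho>" and D: "prob_space D" and sp: "space D \<subseteq> {E. measurement n E}"
    and meas: "\<And>i j. i < 2 ^ n \<Longrightarrow> j < 2 ^ n \<Longrightarrow> (\<lambda>E. E $$ (i, j)) \<in> borel_measurable D"
    and \<epsilon>: "0 < \<epsilon>" "\<epsilon> < 1" and \<alpha>: "0 < \<gamma> - \<eta>" "\<gamma> - \<eta> < 1" and \<delta>: "0 < \<delta>" "\<delta> < 1"
    and L: "1 / 10 \<le> ln (real n / ((\<gamma> - \<eta>) * \<epsilon>))"
    and m: "100000000 / \<epsilon> * (real n / (\<gamma> - \<eta>)\<^sup>2 * (ln (real n / ((\<gamma> - \<eta>) * \<epsilon>)))\<^sup>2 + ln (1 / \<delta>)) \<le> real m"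
  shows "\<exists>A\<in>sets (PiM {..<m} (\<lambda>_. D)). A \<subseteq> {Es. good n \<rho> D \<epsilon> \<eta> \<gamma> m Es} \<and>
          measure (PiM {..<m} (\<lambda>_. D)) A \<ge> 1 - \<delta>"
proof -
  define \<alpha>' where "\<alpha>' = \<gamma> - \<eta>"
  define d where "d = (2::nat) ^ n"
  obtain r where r: "r \<ge> 1" "n \<le> 2 ^ r" "2 ^ r \<le> 2 * n" using power_of_two_between[OF n] by blast
  define q where "q = (2::nat) ^ r"
  have q: "n \<le> q" "q \<le> 2 * n" "0 < q" using r by (auto simp: q_def)
  have dq: "real d powr (2 / real q) \<le> 4" unfolding d_def using two_powr_dim_le[OF q(1,3)] .
  define T where "T = nat \<lfloor>1 + 4 * real q / \<alpha>'\<^sup>2\<rfloor>"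
  have \<alpha>'2: "0 < \<alpha>'\<^sup>2" "\<alpha>'\<^sup>2 \<le> 1" using \<alpha> by (auto simp: \<alpha>'_def intro: power_le_one)
  have T: "real T \<le> 9 * (real n / \<alpha>'\<^sup>2)"
  proof -
    have "real T \<le> 1 + 4 * real q / \<alpha>'\<^sup>2" unfolding T_def by (intro of_nat_floor) simp
    also have "4 * real q / \<alpha>'\<^sup>2 \<le> 8 * real n / \<alpha>'\<^sup>2" using q by (intro divide_right_mono) auto
    also have "1 \<le> real n / \<alpha>'\<^sup>2" using n \<alpha>'2 by (simp add: field_simps)
    finally show ?thesis by simp
  qed
  have big: "5 \<le> \<epsilon> * real m" and small: "2 * (4 * real m + 1) ^ T * 2 powr (- (\<epsilon> * real m / 2)) \<le> \<delta>"
    using sample_size_arith[OF n \<alpha> \<epsilon> \<delta> refl L m T[unfolded \<alpha>'_def]] by blast+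
  define Cs where "Cs = {xs. set xs \<subseteq> {..<2 * m} \<times> (UNIV :: bool set) \<and> length xs \<le> T}"
  have Cs: "finite Cs" unfolding Cs_def by (rule finite_lists_length_le) simp
  \<comment> \<open>Two signs for each of the 2m positions give 4m letters.\<close>
  have "card Cs \<le> (card ({..<2 * m} \<times> (UNIV :: bool set)) + 1) ^ T"
    unfolding Cs_def by (rule card_short_lists_le) simp
  also have "\<dots> = (4 * m + 1) ^ T" by (simp add: card_cartesian_product)
  finally have "real (card Cs) \<le> real ((4 * m + 1) ^ T)" by (rule of_nat_mono)
  then have cardCs: "real (card Cs) \<le> (4 * real m + 1) ^ T" by (simp add: add.commute)
  \<comment> \<open>Subtracting the score of \<rho> makes \<open>V\<close> approximate the score
    difference of a state from \<rho>.\<close>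
  define V where "V z xs i = \<alpha>' / (4 * real q) * gradient d q (signed_sum (\<lambda>j. obs d (z j)) xs) (obs d (z i)) - score n \<rho> (z i)"
    for z :: "nat \<Rightarrow> complex mat" and xs i
  define F where "F = (\<lambda>\<sigma> E. score n \<sigma> E - score n \<rho> E) ` {\<sigma>. qstate n \<sigma>}"
  have om: "(\<lambda>E. obs d E i j) \<in> borel_measurable D" for i j
    unfolding d_def by (rule borel_measurable_obs) (rule meas)
  have sm: "score n \<sigma> \<in> borel_measurable D" for \<sigma>
    unfolding score_def d_def[symmetric] by (intro borel_measurable_mtr borel_measurable_mmul om) simp
  have ozm: "(\<lambda>z. obs d (z l) i j) \<in> borel_measurable (PiM {..<2 * m} (\<lambda>_. D))" if "l < 2 * m" for l i j
    using om that by (intro measurable_compose[OF measurable_component_singleton]) auto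
  have "\<exists>A\<in>sets (PiM {..<m} (\<lambda>_. D)).
    A \<subseteq> {x. \<forall>f\<in>F. (\<forall>i<m. \<bar>f (x i)\<bar> \<le> 2 * \<eta>) \<longrightarrow> measure D {E \<in> space D. \<bar>f E\<bar> > 2 * \<gamma>} \<le> \<epsilon>} \<and>
    measure (PiM {..<m} (\<lambda>_. D)) A \<ge> 1 - 2 * real (card Cs) * 2 powr (- (\<epsilon> * real m / 2))"
  \<comment> \<open>Scores double the thresholds, so 2 \<eta> + 2 \<alpha>' = 2 \<gamma> and the
    full gap is available as precision.\<close>
  proof (rule ghost_sample_bound[where V = V and \<beta> = \<alpha>'])
    show "f \<in> borel_measurable D" if "f \<in> F" for f
      using that sm unfolding F_def by auto
    show "(\<lambda>z. V z c i) \<in> borel_measurable (PiM {..<2 * m} (\<lambda>_. D))" if "c \<in> Cs" "i < 2 * m" for c i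
    proof -
      have "(\<lambda>z. score n \<rho> (z i)) \<in> borel_measurable (PiM {..<2 * m} (\<lambda>_. D))"
        using sm that by (intro measurable_compose[OF measurable_component_singleton]) auto
      moreover have "(\<lambda>z. gradient d q (signed_sum (\<lambda>j. obs d (z j)) c) (obs d (z i)))
          \<in> borel_measurable (PiM {..<2 * m} (\<lambda>_. D))"
        using that by (intro borel_measurable_gradient borel_measurable_signed_sum ozm) (auto simp: Cs_def)
      ultimately show ?thesis unfolding V_def by measurable
    qed
    show "\<exists>c\<in>Cs. \<forall>i<2 * m. \<bar>V z c i - f (z i)\<bar> \<le> \<alpha>'"
      if z: "z \<in> space (PiM {..<2 * m} (\<lambda>_. D))" and f: "f \<in> F" for z f
    proof -
      obtain \<sigma> where \<sigma>: "qstate n \<sigma>" "f = (\<lambda>E. score n \<sigma> E - score n \<rho> E)" using f by (auto simp: F_def)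
      have zi: "contraction d (obs d (z i))" if "i \<in> {..<2 * m}" for i
        unfolding d_def using z sp that by (intro contraction_obs) (auto simp: space_PiM PiE_iff)
      have "\<exists>xs. set xs \<subseteq> {..<2 * m} \<times> UNIV \<and> real (length xs) \<le> 1 + 4 * real q / \<alpha>'\<^sup>2 \<and>
        (\<forall>i\<in>{..<2 * m}. \<bar>\<alpha>' / (4 * real q) * gradient d q (signed_sum (\<lambda>i. obs d (z i)) xs) (obs d (z i))
            - mtr d (mmul d (obs d (z i)) (fmat d \<sigma>))\<bar> \<le> \<alpha>')"
        by (rule signed_sum_cover[OF qstate_posf[OF \<sigma>(1), folded d_def] zi q_def r(1) dq])
           (use \<alpha> in \<open>simp_all add: \<alpha>'_def\<close>)
      then obtain xs where xs: "set xs \<subseteq> {..<2 * m} \<times> UNIV" "real (length xs) \<le> 1 + 4 * real q / \<alpha>'\<^sup>2"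
        "\<forall>i\<in>{..<2 * m}. \<bar>\<alpha>' / (4 * real q) * gradient d q (signed_sum (\<lambda>i. obs d (z i)) xs) (obs d (z i))
            - mtr d (mmul d (obs d (z i)) (fmat d \<sigma>))\<bar> \<le> \<alpha>'"
        by blast
      have "xs \<in> Cs" using xs(1) le_nat_floor[OF xs(2)] unfolding Cs_def T_def by blast
      moreover have "\<forall>i<2 * m. \<bar>V z xs i - f (z i)\<bar> \<le> \<alpha>'"
        using xs(3) by (auto simp: V_def \<sigma>(2) score_def d_def)
      ultimately show ?thesis by blast
    qed
    show "\<exists>c'\<in>Cs. \<forall>i<2 * m. V (\<lambda>j\<in>{..<2 * m}. z (\<pi> j)) c i = V z c' (\<pi> i)"
      if "z \<in> space (PiM {..<2 * m} (\<lambda>_. D))" and c: "c \<in> Cs" and \<pi>: "\<pi> permutes {..<2 * m}" for z c \<pi>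
    proof (intro bexI[of _ "map (map_prod \<pi> id) c"] allI impI)
      show "map (map_prod \<pi> id) c \<in> Cs"
        using c permutes_in_image[OF \<pi>] by (fastforce simp: Cs_def)
      fix i assume "i < 2 * m"
      moreover have "signed_sum (\<lambda>j. obs d ((\<lambda>j\<in>{..<2 * m}. z (\<pi> j)) j)) c
          = signed_sum (\<lambda>j. obs d (z j)) (map (map_prod \<pi> id) c)"
        using c by (intro signed_sum_map) (auto simp: Cs_def)
      ultimately show "V (\<lambda>j\<in>{..<2 * m}. z (\<pi> j)) c i = V z (map (map_prod \<pi> id) c) (\<pi> i)"
        by (simp add: V_def)
    qed
  qed (use D Cs big in \<open>auto simp: \<alpha>'_def\<close>)
  then obtain A where A: "A \<in> sets (PiM {..<m} (\<lambda>_. D))"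
    "A \<subseteq> {x. \<forall>f\<in>F. (\<forall>i<m. \<bar>f (x i)\<bar> \<le> 2 * \<eta>) \<longrightarrow> measure D {E \<in> space D. \<bar>f E\<bar> > 2 * \<gamma>} \<le> \<epsilon>}"
    "measure (PiM {..<m} (\<lambda>_. D)) A \<ge> 1 - 2 * real (card Cs) * 2 powr (- (\<epsilon> * real m / 2))" by blast
  have "A \<subseteq> {Es. good n \<rho> D \<epsilon> \<eta> \<gamma> m Es}"
  proof
    fix x assume x: "x \<in> A"
    then have "x \<in> space (PiM {..<m} (\<lambda>_. D))" using A(1) sets.sets_into_space by blast
    then have "\<And>i. i < m \<Longrightarrow> x i \<in> space D" by (auto simp: space_PiM PiE_iff)
    then show "x \<in> {Es. good n \<rho> D \<epsilon> \<eta> \<gamma> m Es}"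
      using A(2) x by (auto simp: good_iff_score[OF \<rho> sp] F_def)
  qed
  moreover have le: "2 * real (card Cs) * 2 powr (- (\<epsilon> * real m / 2)) \<le> 2 * (4 * real m + 1) ^ T * 2 powr (- (\<epsilon> * real m / 2))"
    using cardCs by (intro mult_right_mono mult_left_mono) auto
  moreover have "measure (PiM {..<m} (\<lambda>_. D)) A \<ge> 1 - \<delta>" using A(3) small le by linarith
  ultimately show ?thesis using A(1) by blast
qed

section \<open>A single qubit with a large gap\<close>

lemma contraction_mtr_square:
  assumes "contraction d H" shows "mtr d (mmul d H H) \<le> real d"
proof -
  have "mtr d (mpow d H (2 ^ 1)) \<le> real d" using assms unfolding contraction_def by blast
  moreover have "mpow d H (2 ^ 1) = mmul d H H"
    using mpow_square[OF contraction_herm[OF assms], of 1] contraction_herm[OF assms] by simp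
  ultimately show ?thesis by simp
qed

text \<open>With t the trace of S^2, Cauchy-Schwarz gives t^2 \<le> Tr S^3, and S \<le> 1 gives Tr
  S^3 \<le> t.\<close>

lemma state_purity_le:
  assumes "posf d S" "mtr d S = 1" shows "mtr d (mmul d S S) \<le> 1"
proof -
  let ?t = "mtr d (mmul d S S)"
  have h: "herm d S" using assms(1) by (rule posf_herm)
  have "?t\<^sup>2 \<le> mtr d (mmul d (mmul d S S) S)" using posf_mtr_mul_sq[OF assms(1) h] assms(2) by simp
  also have "\<dots> \<le> ?t" using posf_mtr_le[OF assms(1), of S] assms(2) h by (simp add: herm_adj mmul_assoc)
  finally have "?t * ?t \<le> ?t * 1" by (simp add: power2_eq_square)
  then show ?thesis using mtr_sq_nonneg[OF h] by (cases "?t = 0") (auto simp: mult_le_cancel_left_pos)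
qed

text \<open>In dimension two, a state that some effect distinguishes almost perfectly from \<open>\<rho>\<close> is close
  to the complementary operator \<open>1 - \<rho>\<close>, so any two such states are close to each other.\<close>

lemma qubit_far_state:
  assumes R: "posf 2 R" "mtr 2 R = 1" and S: "posf 2 S" "mtr 2 S = 1" and H0: "contraction 2 H0" and H: "contraction 2 H"
    and far: "2 * \<gamma> < \<bar>mtr 2 (mmul 2 H0 S) - mtr 2 (mmul 2 H0 R)\<bar>" and \<gamma>: "9 / 10 \<le> \<gamma>"
  shows "\<bar>mtr 2 (mmul 2 H S) + mtr 2 (mmul 2 H R) - mtr 2 (mmul 2 H (mone 2))\<bar> < 9 / 10"
proof -
  define c where "c = mtr 2 (mmul 2 S R)"
  have hS: "herm 2 S" and hR: "herm 2 R" using S R posf_herm by auto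
  have CS: "(mtr 2 (mmul 2 H X))\<^sup>2 \<le> 2 * mtr 2 (mmul 2 X X)" if H: "contraction 2 H" and X: "herm 2 X" for H X
  proof -
    have "(mtr 2 (mmul 2 H X))\<^sup>2 \<le> mtr 2 (mmul 2 H H) * mtr 2 (mmul 2 X X)"
      by (rule mtr_Cauchy_Schwarz[OF contraction_herm[OF H] X])
    also have "\<dots> \<le> 2 * mtr 2 (mmul 2 X X)"
      using contraction_mtr_square[OF H] mtr_sq_nonneg[OF X] by (intro mult_right_mono) auto
    finally show ?thesis .
  qed
  have pS: "mtr 2 (mmul 2 S S) \<le> 1" and pR: "mtr 2 (mmul 2 R R) \<le> 1" using state_purity_le S R by auto
  define X where "X = mlin S (- 1) R"
  have "(2 * \<gamma>)\<^sup>2 < \<bar>mtr 2 (mmul 2 H0 S) - mtr 2 (mmul 2 H0 R)\<bar>\<^sup>2"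
    using far \<gamma> by (intro power_strict_mono) auto
  also have "\<bar>mtr 2 (mmul 2 H0 S) - mtr 2 (mmul 2 H0 R)\<bar>\<^sup>2 = (mtr 2 (mmul 2 H0 X))\<^sup>2"
    by (simp add: X_def mmul_mlin_right mtr_mlin)
  also have "\<dots> \<le> 2 * mtr 2 (mmul 2 X X)" unfolding X_def by (intro CS H0 herm_mlin hS hR)
  also have "mtr 2 (mmul 2 X X) = mtr 2 (mmul 2 S S) - 2 * c + mtr 2 (mmul 2 R R)"
    by (simp add: X_def mmul_mlin_right mmul_mlin_left mtr_mlin c_def mtr_comm[of 2 R S])
  \<comment> \<open>Being far from \<open>R\<close> forces a small overlap \<open>c\<close> of
    \<open>S\<close> and \<open>R\<close>, because both purities are at most 1.\<close>
  finally have c: "2 * \<gamma>\<^sup>2 < 2 - 2 * c" using pS pR by (simp add: power_mult_distrib)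
  have g: "81 / 100 \<le> \<gamma>\<^sup>2" using power_mono[OF \<gamma>, of 2] by (simp add: power2_eq_square)
  define Y where "Y = mlin (mlin S 1 R) (- 1) (mone 2)"
  have "(mtr 2 (mmul 2 H Y))\<^sup>2 \<le> 2 * mtr 2 (mmul 2 Y Y)"
    unfolding Y_def by (intro CS H herm_mlin hS hR herm_mone)
  also have "mtr 2 (mmul 2 Y Y) = mtr 2 (mmul 2 S S) + 2 * c + mtr 2 (mmul 2 R R) - 2"
    using S(2) R(2) hS hR
    by (simp add: Y_def mmul_mlin_right mmul_mlin_left mtr_mlin c_def mtr_comm[of 2 R S] herm_mone mtr_mone)
  \<comment> \<open>The trace of Y^2 is at most 2c < 2 - 2 \<gamma>^2 \<le> 0.38, and 0.76 <
    0.81.\<close>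
  also have "2 * \<dots> < (9 / 10)\<^sup>2" using c g pS pR by (simp add: power2_eq_square)
  finally have "\<bar>mtr 2 (mmul 2 H Y)\<bar>\<^sup>2 < (9 / 10)\<^sup>2" by simp
  then have "\<bar>mtr 2 (mmul 2 H Y)\<bar> < 9 / 10" by (rule power_less_imp_less_base) simp
  then show ?thesis by (simp add: Y_def mmul_mlin_right mtr_mlin)
qed

text \<open>\<open>E0\<close> and \<open>E1\<close> certify that both states are far from \<rho>.
  Their scores on \<open>E\<close> are then within 9/10 of a common value, hence differ by less than
  9/5 \<le> 2 (\<gamma> - \<eta>).\<close>

lemma qubit_scores_agree:
  assumes \<rho>: "qstate 1 \<rho>" and s: "qstate 1 \<sigma>" "qstate 1 \<sigma>'"
    and E: "measurement 1 E0" "measurement 1 E1" "measurement 1 E" and \<gamma>: "9 / 10 \<le> \<gamma> - \<eta>" "0 \<le> \<eta>"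
    and far: "2 * \<gamma> < \<bar>score 1 \<sigma> E0 - score 1 \<rho> E0\<bar>" "2 * \<gamma> < \<bar>score 1 \<sigma>' E1 - score 1 \<rho> E1\<bar>"
      "2 * \<gamma> < \<bar>score 1 \<sigma> E - score 1 \<rho> E\<bar>"
  shows "2 * \<eta> < \<bar>score 1 \<sigma>' E - score 1 \<rho> E\<bar>"
proof -
  note S = qstate_posf[OF s(1), simplified] and S' = qstate_posf[OF s(2), simplified]
    and R = qstate_posf[OF \<rho>, simplified] and C = contraction_obs[OF E(1), simplified] contraction_obs[OF E(2), simplified]
      contraction_obs[OF E(3), simplified]
  have \<gamma>': "9 / 10 \<le> \<gamma>" using \<gamma> by simp
  define o1 where "o1 = mtr 2 (mmul 2 (obs 2 E) (mone 2))"
  have "\<bar>score 1 \<sigma> E + score 1 \<rho> E - o1\<bar> < 9 / 10"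
    using qubit_far_state[OF R S C(1,3) _ \<gamma>'] far(1) by (simp add: score_def o1_def)
  moreover have "\<bar>score 1 \<sigma>' E + score 1 \<rho> E - o1\<bar> < 9 / 10"
    using qubit_far_state[OF R S' C(2,3) _ \<gamma>'] far(2) by (simp add: score_def o1_def)
  ultimately show ?thesis using far(3) \<gamma> by linarith
qed

text \<open>If some state \<sigma> violates the conclusion, a sample with one effect in
  \<open>far \<sigma>\<close> refutes every other violating state too. All m draws miss
  \<open>far \<sigma>\<close> with probability at most exp(-\<epsilon>m) \<le> \<delta>.\<close>

lemma good_qubit:
  fixes D :: "complex mat measure"
  assumes \<rho>: "qstate 1 \<rho>" and D: "prob_space D" and sp: "space D \<subseteq> {E. measurement 1 E}"
    and meas: "\<And>i j. i < 2 \<Longrightarrow> j < 2 \<Longrightarrow> (\<lambda>E. E $$ (i, j)) \<in> borel_measurable D"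
    and \<epsilon>: "0 < \<epsilon>" and \<alpha>: "9 / 10 \<le> \<gamma> - \<eta>" "0 \<le> \<eta>" and \<delta>: "0 < \<delta>"
    and m: "ln (1 / \<delta>) \<le> \<epsilon> * real m"
  shows "\<exists>A\<in>sets (PiM {..<m} (\<lambda>_. D)). A \<subseteq> {Es. good 1 \<rho> D \<epsilon> \<eta> \<gamma> m Es} \<and>
          measure (PiM {..<m} (\<lambda>_. D)) A \<ge> 1 - \<delta>"
proof -
  interpret D: prob_space D by fact
  interpret P: finite_product_prob_space "\<lambda>_. D" "{..<m}" by standard simp
  define far where "far \<sigma> = {E \<in> space D. \<bar>score 1 \<sigma> E - score 1 \<rho> E\<bar> > 2 * \<gamma>}" for \<sigma>
  have good: "good 1 \<rho> D \<epsilon> \<eta> \<gamma> m Es \<longleftrightarrow> (\<forall>\<sigma>. qstate 1 \<sigma> \<longrightarrow>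
      (\<forall>i<m. \<bar>score 1 \<sigma> (Es i) - score 1 \<rho> (Es i)\<bar> \<le> 2 * \<eta>) \<longrightarrow> measure D (far \<sigma>) \<le> \<epsilon>)"
    if "Es \<in> space (PiM {..<m} (\<lambda>_. D))" for Es
    unfolding far_def using that by (intro good_iff_score \<rho> sp) (auto simp: space_PiM PiE_iff)
  show ?thesis
  proof (cases "\<exists>\<sigma>. qstate 1 \<sigma> \<and> \<epsilon> < measure D (far \<sigma>)")
    case False
    then show ?thesis using good \<delta> by (intro bexI[of _ "space (PiM {..<m} (\<lambda>_. D))"]) (auto simp: P.P.prob_space not_less)
  next
    case True
    then obtain \<sigma> where \<sigma>: "qstate 1 \<sigma>" "\<epsilon> < measure D (far \<sigma>)" by blast
    have "(\<lambda>E. obs 2 E i j) \<in> borel_measurable D" for i j by (rule borel_measurable_obs) (rule meas)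
    then have "score 1 \<tau> \<in> borel_measurable D" for \<tau>
      unfolding score_def by (simp, intro borel_measurable_mtr borel_measurable_mmul) auto
    note this [measurable]
    have far: "far \<sigma> \<in> sets D" unfolding far_def by measurable
    have ne: "\<exists>E. E \<in> far \<tau>" if "\<epsilon> < measure D (far \<tau>)" for \<tau> using that \<epsilon> by (cases "far \<tau> = {}") auto
    define B where "B = (\<Pi>\<^sub>E i\<in>{..<m}. space D - far \<sigma>)"
    have B: "B \<in> sets (PiM {..<m} (\<lambda>_. D))" unfolding B_def using far by (intro sets_PiM_I_finite) auto
    have "measure (PiM {..<m} (\<lambda>_. D)) B = (1 - measure D (far \<sigma>)) ^ m"
      unfolding B_def using far by (subst P.prob_times) (auto simp: D.prob_compl)
    also have "\<dots> \<le> exp (- \<epsilon>) ^ m"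
      using \<sigma>(2) exp_ge_add_one_self[of "- \<epsilon>"] by (intro power_mono) auto
    also have "\<dots> = exp (- (\<epsilon> * real m))" by (simp flip: exp_of_nat_mult add: mult.commute)
    also have "\<dots> \<le> exp (- ln (1 / \<delta>))" using m by simp
    also have "\<dots> = \<delta>" using \<delta> by (simp add: ln_div)
    finally have "measure (PiM {..<m} (\<lambda>_. D)) (space (PiM {..<m} (\<lambda>_. D)) - B) \<ge> 1 - \<delta>"
      by (simp add: P.P.prob_compl[OF B])
    moreover have "good 1 \<rho> D \<epsilon> \<eta> \<gamma> m x" if x: "x \<in> space (PiM {..<m} (\<lambda>_. D)) - B" for x
    proof -
      have xs: "x \<in> space (PiM {..<m} (\<lambda>_. D))" using x by simp
      obtain i where i: "i < m" "x i \<in> far \<sigma>" using x by (auto simp: B_def space_PiM PiE_iff)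
      have "measure D (far \<tau>) \<le> \<epsilon>"
        if \<tau>: "qstate 1 \<tau>" "\<forall>i<m. \<bar>score 1 \<tau> (x i) - score 1 \<rho> (x i)\<bar> \<le> 2 * \<eta>" for \<tau>
      proof (rule ccontr)
        assume "\<not> ?thesis"
        then obtain E1 where "E1 \<in> far \<tau>" using ne by force
        then have "2 * \<eta> < \<bar>score 1 \<tau> (x i) - score 1 \<rho> (x i)\<bar>"
          using i(2) sp by (intro qubit_scores_agree[OF \<rho> \<sigma>(1) \<tau>(1) _ _ _ \<alpha>, of "x i" E1]) (auto simp: far_def)
        then show False using \<tau>(2) i(1) by force
      qed
      then show ?thesis using good[OF xs] by blast
    qed
    ultimately show ?thesis using B by (intro bexI[of _ "space (PiM {..<m} (\<lambda>_. D)) - B"]) auto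
  qed
qed

section \<open>Case distinction on the size of the logarithm\<close>

lemma ln_ge_tenth: "10 / 9 \<le> x \<Longrightarrow> 1 / 10 \<le> ln (x :: real)"
proof -
  assume x: "10 / 9 \<le> x"
  have "ln (9 / 10 :: real) \<le> - (1 / 10)" using ln_le_minus_one[of "9 / 10 :: real"] by simp
  moreover have "ln (10 / 9 :: real) = - ln (9 / 10)" by (simp add: ln_div)
  moreover have "ln (10 / 9) \<le> ln x" using x by simp
  ultimately show ?thesis by linarith
qed

theorem theorem2:
  shows "\<exists>K::real. K > 0 \<and>
    (\<forall>(n::nat) \<rho> (D::complex mat measure) (m::nat) (\<epsilon>::real) (\<eta>::real) (\<gamma>::real) (\<delta>::real).
       n \<ge> 1 \<longrightarrow> qstate n \<rho> \<longrightarrow>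
       prob_space D \<longrightarrow> space D \<subseteq> {E. measurement n E} \<longrightarrow>
       (\<forall>i j. i < 2 ^ n \<longrightarrow> j < 2 ^ n \<longrightarrow> (\<lambda>E. E $$ (i, j)) \<in> borel_measurable D) \<longrightarrow>
       \<epsilon> > 0 \<longrightarrow> \<eta> > 0 \<longrightarrow> \<gamma> > \<eta> \<longrightarrow> 0 < \<delta> \<longrightarrow> \<delta> < 1 \<longrightarrow>
       real m \<ge> K / \<epsilon> * (real n / (\<gamma> - \<eta>)\<^sup>2 * (ln (real n / ((\<gamma> - \<eta>) * \<epsilon>)))\<^sup>2
                          + ln (1 / \<delta>)) \<longrightarrow>
       (\<exists>A \<in> sets (PiM {..<m} (\<lambda>_. D)).
          A \<subseteq> {Es. good n \<rho> D \<epsilon> \<eta> \<gamma> m Es} \<and>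
          measure (PiM {..<m} (\<lambda>_. D)) A \<ge> 1 - \<delta>))"
proof (intro exI[of _ 100000000] conjI allI impI)
  fix n :: nat and \<rho> and D :: "complex mat measure" and m :: nat and \<epsilon> \<eta> \<gamma> \<delta> :: real
  assume n: "n \<ge> 1" and \<rho>: "qstate n \<rho>" and D: "prob_space D" and sp: "space D \<subseteq> {E. measurement n E}"
    and meas: "\<forall>i j. i < 2 ^ n \<longrightarrow> j < 2 ^ n \<longrightarrow> (\<lambda>E. E $$ (i, j)) \<in> borel_measurable D"
    and \<epsilon>: "\<epsilon> > 0" and \<eta>: "\<eta> > 0" and \<gamma>: "\<gamma> > \<eta>" and \<delta>: "0 < \<delta>" "\<delta> < 1"
    and m: "100000000 / \<epsilon> * (real n / (\<gamma> - \<eta>)\<^sup>2 * (ln (real n / ((\<gamma> - \<eta>) * \<epsilon>)))\<^sup>2 + ln (1 / \<delta>)) \<le> real m"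
  interpret D: prob_space D by fact
  interpret P: prob_space "PiM {..<m} (\<lambda>_. D)" by (intro prob_space_PiM D)
  show "\<exists>A \<in> sets (PiM {..<m} (\<lambda>_. D)). A \<subseteq> {Es. good n \<rho> D \<epsilon> \<eta> \<gamma> m Es} \<and>
      measure (PiM {..<m} (\<lambda>_. D)) A \<ge> 1 - \<delta>"
  proof (cases "1 \<le> \<gamma> \<or> 1 \<le> \<epsilon>")
    case True
    \<comment> \<open>Acceptance probabilities differ by at most 1 and a probability is at most 1,
      so every sample is good.\<close>
    have "good n \<rho> D \<epsilon> \<eta> \<gamma> m Es" for Es
    proof -
      have "measure D {E \<in> space D. cmod (acc E \<sigma> - acc E \<rho>) > \<gamma>} \<le> \<epsilon>" if \<sigma>: "qstate n \<sigma>" for \<sigma>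
      proof (cases "1 \<le> \<gamma>")
        case True
        have "\<not> cmod (acc E \<sigma> - acc E \<rho>) > \<gamma>" if "E \<in> space D" for E
        proof -
          have E: "measurement n E" using that sp by blast
          show ?thesis
            using score_acc[OF E \<sigma> \<rho>] score_abs_le[OF E \<sigma>] score_abs_le[OF E \<rho>] True by linarith
        qed
        then have none: "{E \<in> space D. cmod (acc E \<sigma> - acc E \<rho>) > \<gamma>} = {}" by blast
        show ?thesis unfolding none using \<epsilon> by simp
      next
        case False
        then have "1 \<le> \<epsilon>" using \<open>1 \<le> \<gamma> \<or> 1 \<le> \<epsilon>\<close> by blast
        then show ?thesis using D.prob_le_1 order_trans by blast
      qed
      then show ?thesis by (simp add: good_def)
    qed
    then show ?thesis using \<delta> by (intro bexI[of _ "space (PiM {..<m} (\<lambda>_. D))"]) (auto simp: P.prob_space)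
  next
    case False
    then have lt: "\<gamma> < 1" "\<epsilon> < 1" by auto
    have \<alpha>: "0 < \<gamma> - \<eta>" "\<gamma> - \<eta> < 1" using \<eta> \<gamma> lt by auto
    show ?thesis
    proof (cases "n = 1 \<and> 9 / 10 \<le> \<gamma> - \<eta>")
      case True
      have l: "0 \<le> ln (1 / \<delta>)" using \<delta> by simp
      have "ln (1 / \<delta>) \<le> 100000000 * (real n / (\<gamma> - \<eta>)\<^sup>2 * (ln (real n / ((\<gamma> - \<eta>) * \<epsilon>)))\<^sup>2 + ln (1 / \<delta>))"
      proof -
        have "0 \<le> real n / (\<gamma> - \<eta>)\<^sup>2 * (ln (real n / ((\<gamma> - \<eta>) * \<epsilon>)))\<^sup>2" by simp
        moreover have "b \<le> 100000000 * (a + b)" if "0 \<le> a" "0 \<le> b" for a b :: real using that by simp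
        ultimately show ?thesis using l by blast
      qed
      also have "\<dots> \<le> \<epsilon> * real m" using m \<epsilon> by (simp add: field_simps)
      finally show ?thesis
        using True good_qubit[of \<rho> D \<epsilon> \<gamma> \<eta> \<delta> m] \<rho> D sp meas \<epsilon> \<eta> \<delta> by auto
    next
      case False
      \<comment> \<open>Outside the qubit case either n \<ge> 2 or the gap is below 9/10; each keeps
        the argument of the logarithm at least 10/9.\<close>
      have "10 / 9 * ((\<gamma> - \<eta>) * \<epsilon>) \<le> real n"
      proof (cases "n = 1")
        case True
        then have "\<gamma> - \<eta> < 9 / 10" using False by simp
        then have "(\<gamma> - \<eta>) * \<epsilon> \<le> 9 / 10 * 1" using \<alpha> \<epsilon> lt by (intro mult_mono) auto
        then show ?thesis using True by simp
      next
        case False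
        have "(\<gamma> - \<eta>) * \<epsilon> \<le> 1 * 1" using \<alpha> \<epsilon> lt by (intro mult_mono) auto
        moreover have "2 \<le> real n" using False n by simp
        ultimately show ?thesis by linarith
      qed
      then have "1 / 10 \<le> ln (real n / ((\<gamma> - \<eta>) * \<epsilon>))"
        using \<alpha> \<epsilon> by (intro ln_ge_tenth) (simp add: field_simps)
      then show ?thesis
        using good_with_high_probability[OF n \<rho> D sp _ \<epsilon> lt(2) \<alpha> \<delta> _ m] meas by blast
    qed
  qed
qed simp_all

end
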